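(* For every $h>0$, the operator $P=P(h)$ on $L^2(\mathbb R)$ with domain $\mathcal D$ has no positive eigenvalues; that is, there are no $E>0$ and nonzero $u\in\mathcal D$ with $Pu=Eu$.
   Context: For each $h>0$, $V=V(x;h)$ is a real, finite signed Borel measure on $\mathbb R$, which may depend on $h$. Each $u\in H^1(\mathbb R)$ has a unique bounded continuous representative $u_c$; the product of $u$ and $V$ is the complex Borel measure $u_cV$, and one defines, in the sense of distributions on $\mathbb R$, $$Pu=P(h)u=-h^2\partial_x^2u+u_cV .$$ The domain of $P$ is $\mathcal D=\{u\in H^1(\mathbb R): u'\in L^\infty(\mathbb R),\ Pu\in L^2(\mathbb R)\}$. *)

theory Defs
  imports "HOL-Analysis.Analysis"
begin

text \<open>
  Finite signed and complex Borel measures on the line are set functions; only their values on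
  Borel sets are relevant.
\<close>

definition finite_signed_borel_measure :: "(real set \<Rightarrow> real) \<Rightarrow> bool" where
  "finite_signed_borel_measure m \<longleftrightarrow>
     m {} = 0 \<and>
     (\<forall>A :: nat \<Rightarrow> real set. range A \<subseteq> sets borel \<longrightarrow> disjoint_family A \<longrightarrow>
        (\<lambda>i. m (A i)) sums m (\<Union>i. A i))"

text \<open>
  The positive part of the Jordan decomposition. The map \<^const>\<open>ennreal\<close> sends negative reals to
  \<open>0\<close>, which does not change the supremum since \<open>B = {}\<close> already contributes \<open>0\<close>.
\<close>

definition pos_variation :: "(real set \<Rightarrow> real) \<Rightarrow> real measure" where
  "pos_variation m =
     measure_of UNIV (sets borel) (\<lambda>A. SUP B\<in>{B \<in> sets borel. B \<subseteq> A}. ennreal (m B))"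

definition neg_variation :: "(real set \<Rightarrow> real) \<Rightarrow> real measure" where
  "neg_variation m = pos_variation (\<lambda>A. - m A)"

definition signed_integral :: "(real set \<Rightarrow> real) \<Rightarrow> (real \<Rightarrow> complex) \<Rightarrow> complex" where
  "signed_integral m f = (LINT x|pos_variation m. f x) - (LINT x|neg_variation m. f x)"

definition complex_measure_integral :: "(real set \<Rightarrow> complex) \<Rightarrow> (real \<Rightarrow> complex) \<Rightarrow> complex" where
  "complex_measure_integral \<mu> f =
     signed_integral (\<lambda>A. Re (\<mu> A)) f + \<i> * signed_integral (\<lambda>A. Im (\<mu> A)) f"

definition times_measure :: "(real \<Rightarrow> complex) \<Rightarrow> (real set \<Rightarrow> real) \<Rightarrow> real set \<Rightarrow> complex" where
  "times_measure f m A = signed_integral m (\<lambda>x. indicator A x * f x)"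

definition fun_deriv :: "(real \<Rightarrow> complex) \<Rightarrow> real \<Rightarrow> complex" where
  "fun_deriv f = (\<lambda>x. vector_derivative f (at x))"

definition test_function :: "(real \<Rightarrow> complex) \<Rightarrow> bool" where
  "test_function \<phi> \<longleftrightarrow>
     (\<forall>k x. (fun_deriv ^^ k) \<phi> differentiable (at x)) \<and>
     compact (closure {x. \<phi> x \<noteq> 0})"

text \<open>
  Distributions are represented by functionals \<open>T\<close> whose values on test functions are the
  relevant ones, so equality of distributions is \<open>dist_eq\<close>, not equality of functionals. The
  pairings are bilinear (no complex conjugation).
\<close>

type_synonym distrib = "(real \<Rightarrow> complex) \<Rightarrow> complex"

definition dist_eq :: "distrib \<Rightarrow> distrib \<Rightarrow> bool" where
  "dist_eq S T \<longleftrightarrow> (\<forall>\<phi>. test_function \<phi> \<longrightarrow> S \<phi> = T \<phi>)"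

definition dist_of_fun :: "(real \<Rightarrow> complex) \<Rightarrow> distrib" where
  "dist_of_fun u \<phi> = (LINT x|lborel. u x * \<phi> x)"

definition dist_of_measure :: "(real set \<Rightarrow> complex) \<Rightarrow> distrib" where
  "dist_of_measure \<mu> \<phi> = complex_measure_integral \<mu> \<phi>"

definition dist_deriv :: "distrib \<Rightarrow> distrib" where
  "dist_deriv T \<phi> = - T (fun_deriv \<phi>)"

text \<open>
  Elements of Lebesgue and Sobolev spaces are represented by Borel measurable functions; all
  notions below are invariant under changes on null sets.
\<close>

definition L2 :: "(real \<Rightarrow> complex) set" where
  "L2 = {u. u \<in> borel_measurable lborel \<and> integrable lborel (\<lambda>x. (norm (u x))\<^sup>2)}"

definition Linfty :: "(real \<Rightarrow> complex) set" where
  "Linfty = {u. u \<in> borel_measurable lborel \<and> (\<exists>C. AE x in lborel. norm (u x) \<le> C)}"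

definition weak_deriv :: "(real \<Rightarrow> complex) \<Rightarrow> (real \<Rightarrow> complex) \<Rightarrow> bool" where
  "weak_deriv u g \<longleftrightarrow> dist_eq (dist_deriv (dist_of_fun u)) (dist_of_fun g)"

definition H1 :: "(real \<Rightarrow> complex) set" where
  "H1 = {u \<in> L2. \<exists>g \<in> L2. weak_deriv u g}"

definition cont_rep :: "(real \<Rightarrow> complex) \<Rightarrow> real \<Rightarrow> complex" where
  "cont_rep u =
     (THE v. continuous_on UNIV v \<and> bounded (range v) \<and> (AE x in lborel. v x = u x))"

definition schroedinger :: "real \<Rightarrow> (real set \<Rightarrow> real) \<Rightarrow> (real \<Rightarrow> complex) \<Rightarrow> distrib" where
  "schroedinger h V u \<phi> =
     - ((complex_of_real h)\<^sup>2 * dist_deriv (dist_deriv (dist_of_fun u)) \<phi>)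
     + dist_of_measure (times_measure (cont_rep u) V) \<phi>"

definition schroedinger_domain :: "real \<Rightarrow> (real set \<Rightarrow> real) \<Rightarrow> (real \<Rightarrow> complex) set" where
  "schroedinger_domain h V =
     {u \<in> H1. (\<exists>g \<in> Linfty. weak_deriv u g) \<and>
              (\<exists>f \<in> L2. dist_eq (schroedinger h V u) (dist_of_fun f))}"

definition schroedinger_eigenvalue :: "real \<Rightarrow> (real set \<Rightarrow> real) \<Rightarrow> complex \<Rightarrow> bool" where
  "schroedinger_eigenvalue h V z \<longleftrightarrow>
     (\<exists>u \<in> schroedinger_domain h V.
        \<not> (AE x in lborel. u x = 0) \<and>
        dist_eq (schroedinger h V u) (dist_of_fun (\<lambda>x. z * u x)))"

end

(* Put k = sqrt E / h. Given a nonnegative bump J supported in [a, b], let phi solve phi'' + k^2 phi = J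
   with phi = 0 to the right of b. Testing the eigenvalue equation against phi, cut off far to the
   left (the cutoff costs nothing in the limit since u is in L2), gives
   |int u J| <= C (int J) (int_{(-oo,b)} |u_c| d|V|). Shrinking J towards a point x from the left,
     |u_c(x)| <= C int_{(-oo,x)} |u_c| d|V|,
   and a Gronwall argument starting at -oo forces u_c = 0. The half-line is open at x, so atoms of V
   of arbitrary size do no harm. *)
theory Submission
  imports Defs
begin

section \<open>Smooth functions and bumps\<close>

text \<open>Positivity of \<open>E\<close> enters through \<open>k = sqrt E / h\<close> being real
  and positive: the homogeneous solutions are then the bounded functions \<open>cis (k * x)\<close>
  and \<open>cis (- k * x)\<close>, so phi and phi' stay bounded by a multiple of the mass of the
  bump all the way to -oo. The cutoff error is therefore a bounded function on a unit interval
  drifting to -oo, where the L2 tail of \<open>u\<close> sends its contribution to 0. Vanishing of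
  phi on the right makes the resulting inequality one-sided, of Volterra type, so a large total mass
  of V is harmless. Two obstacles come from the encoding. \<open>cont_rep\<close> is a definite
  description, so a bounded continuous representative has to be constructed and shown unique before
  anything can be said about u_c. The variations are built by \<open>measure_of\<close> from set
  functions; the proof works with upper bounds for them that hold for every set function, and pays
  in constants: a factor 2 for the two variations of V, 2 for those of each real component of u_c V,
  and 2 for real and imaginary parts, which gives 8.\<close>

definition smooth :: "(real \<Rightarrow> complex) \<Rightarrow> bool" where
  "smooth f \<longleftrightarrow> (\<forall>k x. (fun_deriv ^^ k) f differentiable (at x))"

lemma fun_deriv_eqI:
  assumes "\<And>x. (f has_vector_derivative f' x) (at x)"
  shows "fun_deriv f = f'"
  using assms by (auto simp: fun_deriv_def intro!: ext vector_derivative_at)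

text \<open>All iterated derivatives stay in a class that is closed under differentiation.
  Smoothness thus reduces to exhibiting such a class, without any formula for the k-th
  derivative.\<close>

lemma smooth_coinduct:
  assumes "f \<in> S"
    and step: "\<And>f. f \<in> S \<Longrightarrow> \<exists>f'\<in>S. \<forall>x. (f has_vector_derivative f' x) (at x)"
  shows "smooth f"
proof -
  have "(fun_deriv ^^ k) f \<in> S" for k
  proof (induction k)
    case (Suc k)
    then show ?case using step[OF Suc] fun_deriv_eqI by fastforce
  qed (use assms in simp)
  then have "(fun_deriv ^^ k) f differentiable (at x)" for k x
    using step by (meson has_vector_derivative_def differentiable_def)
  then show ?thesis by (simp add: smooth_def)
qed

lemma smooth_has_vector_derivative:
  assumes "smooth f"
  shows "(f has_vector_derivative fun_deriv f x) (at x)"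
proof -
  have "(fun_deriv ^^ 0) f differentiable (at x)" using assms unfolding smooth_def by blast
  then show ?thesis by (simp add: fun_deriv_def vector_derivative_works)
qed

lemma smooth_fun_deriv: "smooth f \<Longrightarrow> smooth (fun_deriv f)"
  unfolding smooth_def by (metis comp_apply funpow_Suc_right)

lemma smooth_continuous: "smooth f \<Longrightarrow> continuous_on A f"
  by (meson continuous_at_imp_continuous_on has_vector_derivative_continuous smooth_has_vector_derivative)

lemma smooth_measurable [measurable_dest]: "smooth f \<Longrightarrow> f \<in> borel_measurable borel"
  by (intro borel_measurable_continuous_onI smooth_continuous)

lemma smooth_antiderivative:
  assumes "smooth f" "\<And>x. (F has_vector_derivative f x) (at x)"
  shows "smooth F"
proof (rule smooth_coinduct)
  show "F \<in> insert F (Collect smooth)" by simp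
qed (use assms smooth_has_vector_derivative smooth_fun_deriv in blast)

text \<open>The derivative of a product is a sum of products, so the class for the coinduction must
  be closed under both operations. Closing up the smooth functions gives sums and products in one
  argument.\<close>

inductive_set smooth_algebra :: "(real \<Rightarrow> complex) set" where
  base: "smooth f \<Longrightarrow> f \<in> smooth_algebra"
| add: "f \<in> smooth_algebra \<Longrightarrow> g \<in> smooth_algebra \<Longrightarrow> (\<lambda>x. f x + g x) \<in> smooth_algebra"
| mult: "f \<in> smooth_algebra \<Longrightarrow> g \<in> smooth_algebra \<Longrightarrow> (\<lambda>x. f x * g x) \<in> smooth_algebra"

lemma smooth_algebra_smooth: "f \<in> smooth_algebra \<Longrightarrow> smooth f"
proof (erule smooth_coinduct)
  fix f assume "f \<in> smooth_algebra"
  then show "\<exists>f'\<in>smooth_algebra. \<forall>x. (f has_vector_derivative f' x) (at x)"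
  proof induction
    case (base f)
    then show ?case
      by (meson smooth_algebra.base smooth_fun_deriv smooth_has_vector_derivative)
  next
    case (add f g)
    then obtain f' g' where "f' \<in> smooth_algebra" "g' \<in> smooth_algebra"
      "\<And>x. (f has_vector_derivative f' x) (at x)" "\<And>x. (g has_vector_derivative g' x) (at x)"
      by blast
    then show ?case
      by (intro bexI[of _ "\<lambda>x. f' x + g' x"] allI has_vector_derivative_add smooth_algebra.add)
  next
    case (mult f g)
    then obtain f' g' where "f' \<in> smooth_algebra" "g' \<in> smooth_algebra"
      "\<And>x. (f has_vector_derivative f' x) (at x)" "\<And>x. (g has_vector_derivative g' x) (at x)"
      by blast
    then show ?case
      by (intro bexI[of _ "\<lambda>x. f x * g' x + f' x * g x"] allI has_vector_derivative_mult
           smooth_algebra.add smooth_algebra.mult mult.hyps)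
  qed
qed

lemma smooth_add: "smooth f \<Longrightarrow> smooth g \<Longrightarrow> smooth (\<lambda>x. f x + g x)"
  and smooth_mult: "smooth f \<Longrightarrow> smooth g \<Longrightarrow> smooth (\<lambda>x. f x * g x)"
  by (auto intro!: smooth_algebra_smooth intro: smooth_algebra.intros)

lemma smooth_const: "smooth (\<lambda>x. c)"
  by (rule smooth_coinduct[where S = "range (\<lambda>c x. c)"]) (auto intro!: derivative_eq_intros)

lemma smooth_diff: "smooth f \<Longrightarrow> smooth g \<Longrightarrow> smooth (\<lambda>x. f x - g x)"
  using smooth_add[OF _ smooth_mult[OF smooth_const[of "-1"]], of f g] by simp

lemma has_vector_derivative_translate:
  assumes "(f has_vector_derivative f') (at (x + c))"
  shows "((\<lambda>x. f (x + c)) has_vector_derivative f') (at (x::real))"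
proof -
  have "((\<lambda>x. x + c) has_vector_derivative 1) (at x)" by (auto intro!: derivative_eq_intros)
  from vector_diff_chain_at[OF this] assms show ?thesis by (simp add: o_def)
qed

lemma smooth_translate:
  assumes "smooth f" shows "smooth (\<lambda>x. f (x + c))"
proof (rule smooth_coinduct[where S = "(\<lambda>f x. f (x + c)) ` Collect smooth"])
  fix F assume "F \<in> (\<lambda>f x. f (x + c)) ` Collect smooth"
  then obtain f where "smooth f" "F = (\<lambda>x. f (x + c))" by auto
  then show "\<exists>F'\<in>(\<lambda>f x. f (x + c)) ` Collect smooth. \<forall>x. (F has_vector_derivative F' x) (at x)"
    by (intro bexI[of _ "\<lambda>x. fun_deriv f (x + c)"])
      (auto intro!: has_vector_derivative_translate smooth_has_vector_derivative imageI smooth_fun_deriv)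
qed (use assms in auto)

lemma fun_deriv_translate: "smooth f \<Longrightarrow> fun_deriv (\<lambda>x. f (x + c)) = (\<lambda>x. fun_deriv f (x + c))"
  by (intro fun_deriv_eqI has_vector_derivative_translate smooth_has_vector_derivative)

lemma fun_deriv_eq_0:
  assumes "\<And>x. x \<notin> {a..b} \<Longrightarrow> f x = 0" "x \<notin> {a..b}"
  shows "fun_deriv f x = 0"
proof -
  have "((\<lambda>_. 0) has_vector_derivative 0) (at x)" by simp
  then have "(f has_vector_derivative 0) (at x)"
    by (rule has_vector_derivative_transform_within_open[of _ _ _ "- {a..b}"]) (use assms in auto)
  then show ?thesis by (simp add: fun_deriv_def vector_derivative_at)
qed

lemma fun_deriv_mult:
  "smooth f \<Longrightarrow> smooth g \<Longrightarrow> fun_deriv (\<lambda>x. f x * g x) = (\<lambda>x. f x * fun_deriv g x + fun_deriv f x * g x)"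
  by (intro fun_deriv_eqI has_vector_derivative_mult smooth_has_vector_derivative)

lemma fun_deriv_add:
  "smooth f \<Longrightarrow> smooth g \<Longrightarrow> fun_deriv (\<lambda>x. f x + g x) = (\<lambda>x. fun_deriv f x + fun_deriv g x)"
  by (intro fun_deriv_eqI has_vector_derivative_add smooth_has_vector_derivative)

lemma has_vector_derivative_cis:
  "((\<lambda>x. cis (k * x)) has_vector_derivative \<i> * of_real k * cis (k * x)) (at x within A)"
proof -
  have "((\<lambda>x. exp (\<i> * of_real k * of_real x)) has_vector_derivative
      \<i> * of_real k * exp (\<i> * of_real k * of_real x)) (at x within A)"
    by (rule has_vector_derivative_real_field derivative_eq_intros refl | simp)+
  then show ?thesis by (simp add: cis_conv_exp mult.assoc)
qed

lemma smooth_cis: "smooth (\<lambda>x. cis (k * x))"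
proof (rule smooth_coinduct[where S = "range (\<lambda>c x. c * cis (k * x))"])
  show "(\<lambda>x. cis (k * x)) \<in> range (\<lambda>c x. c * cis (k * x))"
    by (rule image_eqI[of _ _ 1]) auto
next
  fix f assume "f \<in> range (\<lambda>c x. c * cis (k * x))"
  then obtain c where f: "f = (\<lambda>x. c * cis (k * x))" by auto
  have "(f has_vector_derivative (c * (\<i> * of_real k)) * cis (k * x)) (at x)" for x
    unfolding f mult.assoc
    by (intro has_vector_derivative_mult_right has_vector_derivative_cis[unfolded mult.assoc])
  then show "\<exists>f'\<in>range (\<lambda>c x. c * cis (k * x)). \<forall>x. (f has_vector_derivative f' x) (at x)"
    by (intro bexI[of _ "\<lambda>x. (c * (\<i> * of_real k)) * cis (k * x)"]) auto
qed

section \<open>Flat functions and smooth bumps\<close>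

definition flat :: "real poly \<Rightarrow> real \<Rightarrow> real" where
  "flat p y = (if y > 0 then poly p (1 / y) * exp (- (1 / y)) else 0)"

lemma poly_times_exp_tendsto_0: "((\<lambda>t. poly p t * exp (- t)) \<longlongrightarrow> (0::real)) at_top"
proof -
  have "((\<lambda>t. \<Sum>i\<le>degree p. coeff p i * (t ^ i / exp t)) \<longlongrightarrow> (\<Sum>i\<le>degree p. coeff p i * 0)) at_top"
    by (intro tendsto_intros tendsto_power_div_exp_0)
  then show ?thesis
    by (simp add: poly_altdef sum_distrib_right exp_minus divide_inverse mult.assoc)
qed

lemma flat_tendsto_0: "(flat p \<longlongrightarrow> 0) (at 0)"
proof (rule filterlim_split_at)
  have "\<forall>\<^sub>F y in at_left 0. flat p y = 0"
    by (auto simp: eventually_at_filter flat_def)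
  then show "(flat p \<longlongrightarrow> 0) (at_left 0)" by (rule tendsto_eventually)
next
  have "((\<lambda>y. poly p (inverse y) * exp (- inverse y)) \<longlongrightarrow> 0) (at_right 0)"
    by (rule filterlim_compose[OF poly_times_exp_tendsto_0 filterlim_inverse_at_top_right])
  moreover have "\<forall>\<^sub>F y in at_right 0. poly p (inverse y) * exp (- inverse y) = flat p y"
    by (auto simp: eventually_at_filter flat_def divide_inverse)
  ultimately show "(flat p \<longlongrightarrow> 0) (at_right 0)" by (rule Lim_transform_eventually)
qed

text \<open>\<open>flat 1\<close> is the classical function exp (-1/y), extended by 0. With t = 1/y,
  differentiating p(t) exp (-t) in y gives t^2 (p - p')(t) exp (-t); the polynomial parameter is
  there to make the family closed under differentiation.\<close>

lemma DERIV_flat: "(flat p has_real_derivative flat ([:0, 0, 1:] * (p - pderiv p)) y) (at y)"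
proof (cases y "0::real" rule: linorder_cases)
  case less
  have "((\<lambda>_. 0) has_real_derivative 0) (at y)" by simp
  then have "(flat p has_real_derivative 0) (at y)"
    by (rule has_field_derivative_transform_within_open[of _ _ _ "{..<0}"])
      (use less in \<open>auto simp: flat_def\<close>)
  with less show ?thesis by (simp add: flat_def)
next
  case equal
  have "((\<lambda>h. (flat p (0 + h) - flat p 0) / h) \<longlongrightarrow> 0) (at 0)"
  \<comment> \<open>Dividing by \<open>h\<close> multiplies the polynomial by its variable 1/h, so
    the difference quotient at 0 is itself a member of the family and tends to 0.\<close>
  proof (rule Lim_transform_eventually[OF flat_tendsto_0[of "pCons 0 p"]])
    show "\<forall>\<^sub>F h in at 0. flat (pCons 0 p) h = (flat p (0 + h) - flat p 0) / h"
      by (auto simp: eventually_at_filter flat_def)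
  qed
  moreover have "flat ([:0, 0, 1:] * (p - pderiv p)) 0 = 0" by (simp add: flat_def)
  ultimately show ?thesis using equal by (simp only: DERIV_def)
next
  case greater
  have "((\<lambda>y. poly p (1 / y) * exp (- (1 / y))) has_real_derivative
      flat ([:0, 0, 1:] * (p - pderiv p)) y) (at y)"
    using greater
    by (auto intro!: derivative_eq_intros simp: flat_def field_simps power2_eq_square)
  then show ?thesis
    by (rule has_field_derivative_transform_within_open[of _ _ _ "{0<..}"])
      (use greater in \<open>auto simp: flat_def\<close>)
qed

text \<open>Each differentiation produces a factor \<open>s\<close> from the inner affine map; the
  scalar \<open>d\<close> in the coinduction class absorbs it. A negative \<open>s\<close> gives the
  right flank of a bump.\<close>

lemma smooth_flat: "smooth (\<lambda>x. of_real (flat p (s * x + c)))"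
proof (rule smooth_coinduct[where S = "range (\<lambda>(p, d) x. of_real (d * flat p (s * x + c)))"])
  show "(\<lambda>x. of_real (flat p (s * x + c))) \<in> range (\<lambda>(p, d) x. complex_of_real (d * flat p (s * x + c)))"
    by (rule image_eqI[of _ _ "(p, 1)"]) auto
next
  fix f assume "f \<in> range (\<lambda>(p, d) x. complex_of_real (d * flat p (s * x + c)))"
  then obtain p d where f: "f = (\<lambda>x. complex_of_real (d * flat p (s * x + c)))" by auto
  have "((\<lambda>x. d * flat p (s * x + c)) has_real_derivative
      (d * s) * flat ([:0, 0, 1:] * (p - pderiv p)) (s * x + c)) (at x)" for x
    by (rule derivative_eq_intros DERIV_chain2[OF DERIV_flat] refl | simp)+
  then have "(f has_vector_derivative
      of_real ((d * s) * flat ([:0, 0, 1:] * (p - pderiv p)) (s * x + c))) (at x)" for x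
    unfolding f by (intro has_vector_derivative_of_real)
  then show "\<exists>f'\<in>range (\<lambda>(p, d) x. complex_of_real (d * flat p (s * x + c))).
      \<forall>x. (f has_vector_derivative f' x) (at x)"
    by (intro bexI[of _ "\<lambda>x. of_real ((d * s) * flat ([:0, 0, 1:] * (p - pderiv p)) (s * x + c))"]
        allI image_eqI[of _ _ "([:0, 0, 1:] * (p - pderiv p), d * s)"]) auto
qed

text \<open>The steepness \<open>Suc n\<close> lets the bumps tend to the indicator of the open
  interval. Where one positive bump is enough, \<open>n = 0\<close> is taken.\<close>

definition bump :: "real \<Rightarrow> real \<Rightarrow> nat \<Rightarrow> real \<Rightarrow> real" where
  "bump a b n x = flat 1 (real (Suc n) * (x - a)) * flat 1 (real (Suc n) * (b - x))"

lemma smooth_bump: "smooth (\<lambda>x. of_real (bump a b n x))"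
  using smooth_mult[OF smooth_flat[of 1 "real (Suc n)" "- (real (Suc n) * a)"] smooth_flat[of 1 "- real (Suc n)" "real (Suc n) * b"]]
  by (simp add: bump_def algebra_simps)

lemma flat_1_bounds: "0 \<le> flat 1 y" "flat 1 y \<le> 1"
  by (auto simp: flat_def)

lemma bump_bounds: "0 \<le> bump a b n x" "bump a b n x \<le> 1"
  unfolding bump_def by (intro mult_nonneg_nonneg mult_le_one flat_1_bounds)+

lemma bump_eq_0: "x \<notin> {a<..<b} \<Longrightarrow> bump a b n x = 0"
  by (auto simp: bump_def flat_def zero_less_mult_iff)

lemma bump_pos: "x \<in> {a<..<b} \<Longrightarrow> 0 < bump a b n x"
  by (auto simp: bump_def flat_def intro!: mult_pos_pos)

lemma bump_le_indicator: "bump a b n x \<le> indicator {a..b} x"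
  using bump_bounds bump_eq_0[of x a b n] by (auto simp: indicator_def)

lemma bump_tendsto: "(\<lambda>n. bump a b n x) \<longlonglongrightarrow> indicator {a<..<b} x"
proof (cases "x \<in> {a<..<b}")
  case True
  have *: "(\<lambda>n. flat 1 (real (Suc n) * d)) \<longlonglongrightarrow> 1" if "d > 0" for d :: real
  proof -
    have "(\<lambda>n. exp (- (inverse d * inverse (real (Suc n))))) \<longlonglongrightarrow> exp (- (inverse d * 0))"
      by (intro tendsto_intros LIMSEQ_inverse_real_of_nat)
    then show ?thesis
      using that by (simp add: flat_def zero_less_mult_iff divide_inverse mult.commute)
  qed
  show ?thesis
    unfolding bump_def using tendsto_mult[OF *[of "x - a"] *[of "b - x"]] True by simp
qed (simp add: bump_eq_0)

lemma bump_measurable [measurable]: "bump a b n \<in> borel_measurable borel"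
proof -
  have "(\<lambda>x. Re (of_real (bump a b n x))) \<in> borel_measurable borel"
    using smooth_measurable[OF smooth_bump[of a b n]] by measurable
  then show ?thesis by simp
qed

lemma integrable_bump: "integrable lborel (bump a b n)"
proof (rule Bochner_Integration.integrable_bound)
  show "integrable lborel (indicator {a..b} :: real \<Rightarrow> real)"
    by (intro integrable_real_indicator) (auto simp: emeasure_lborel_Icc_eq)
  show "AE x in lborel. norm (bump a b n x) \<le> norm (indicator {a..b} x :: real)"
    using bump_bounds bump_le_indicator by (auto intro!: AE_I2)
qed simp

lemma integral_bump_pos:
  assumes "a < b" shows "0 < (LINT x|lborel. bump a b n x)"
proof (rule ccontr)
  assume "\<not> ?thesis"
  then have "(LINT x|lborel. bump a b n x) = 0"
    using Bochner_Integration.integral_nonneg[of lborel "bump a b n", OF bump_bounds(1)] by linarith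
  then have "AE x in lborel. bump a b n x = 0"
    using integral_nonneg_eq_0_iff_AE[OF integrable_bump] bump_bounds by simp
  then have "AE x in lborel. x \<notin> {a<..<b}"
    by eventually_elim (metis bump_pos less_irrefl)
  then have "{a<..<b} \<in> null_sets lborel" by (simp add: AE_iff_null_sets)
  then show False using assms by auto
qed

lemma test_functionI:
  assumes "smooth f" "\<And>x. x \<notin> {a..b} \<Longrightarrow> f x = 0"
  shows "test_function f"
  unfolding test_function_def
proof
  have "closure {x. f x \<noteq> 0} \<subseteq> {a..b}"
    by (rule closure_minimal) (use assms(2) in \<open>blast, simp\<close>)
  then have "bounded (closure {x. f x \<noteq> 0})"
    using bounded_subset bounded_closed_interval by blast
  then show "compact (closure {x. f x \<noteq> 0})" by (simp add: compact_eq_bounded_closed)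
qed (use assms(1) in \<open>simp add: smooth_def\<close>)

section \<open>Primitives of compactly supported functions and the cutoff\<close>

definition prim :: "(real \<Rightarrow> complex) \<Rightarrow> real \<Rightarrow> complex" where
  "prim f y = (LINT t|lborel. indicator {..y} t * f t)"

context
  fixes f :: "real \<Rightarrow> complex" and a b :: real
  assumes cont: "continuous_on UNIV f" and supp: "\<And>x. x \<notin> {a..b} \<Longrightarrow> f x = 0"
begin

lemma integrable_compact_support: "integrable lborel f"
proof -
  have "set_integrable lborel {a..b} f"
    by (intro borel_integrable_atLeastAtMost' continuous_on_subset[OF cont]) simp
  then have "integrable lborel (\<lambda>x. indicator {a..b} x *\<^sub>R f x)"
    by (simp add: set_integrable_def)
  moreover have "(\<lambda>x. indicator {a..b} x *\<^sub>R f x) = f"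
    using supp by (auto simp: indicator_def)
  ultimately show ?thesis by simp
qed

lemma prim_has_vector_derivative: "(prim f has_vector_derivative f y) (at y)"
proof -
  \<comment> \<open>Starting left of the support, the integral from \<open>c\<close> agrees near
    \<open>y\<close> with the integral from -oo; \<open>y\<close> is interior to the interval, so
    the one-sided form of the fundamental theorem becomes a two-sided derivative.\<close>
  define c d where "c = min a y - 1" and "d = y + 1"
  have cd: "c < y" "y < d" "c < a" by (auto simp: c_def d_def)
  have "((\<lambda>u. LBINT t=c..u. f t) has_vector_derivative f y) (at y within {c..d})"
    using cd by (intro interval_integral_FTC2 continuous_on_subset[OF cont]) auto
  then have *: "((\<lambda>u. LBINT t=c..u. f t) has_vector_derivative f y) (at y)"
    using cd by (simp add: at_within_Icc_at)
  show ?thesis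
  proof (rule has_vector_derivative_transform_within_open[OF *])
    fix u assume "u \<in> {c<..<d}"
    then have "(LBINT t=c..u. f t) = (LINT t|lborel. indicator {c<..<u} t *\<^sub>R f t)"
      by (simp add: interval_lebesgue_integral_le_eq set_lebesgue_integral_def)
    also have "\<dots> = prim f u"
      unfolding prim_def
    proof (rule integral_cong_AE)
      show "AE t in lborel. indicator {c<..<u} t *\<^sub>R f t = indicator {..u} t * f t"
        using AE_lborel_singleton[of u]
      proof eventually_elim
        case (elim t)
        then show ?case using supp[of t] cd by (auto simp: indicator_def)
      qed
    qed (use borel_measurable_continuous_onI[OF cont] in measurable)
    finally show "(LBINT t=c..u. f t) = prim f u" .
  qed (use cd in auto)
qed

lemma prim_eq_0: "y < a \<Longrightarrow> prim f y = 0"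
  unfolding prim_def by (rule integral_eq_zero_AE) (use supp in \<open>auto simp: indicator_def\<close>)

lemma prim_eq_integral: "b \<le> y \<Longrightarrow> prim f y = (LINT t|lborel. f t)"
  unfolding prim_def using supp
  by (intro Bochner_Integration.integral_cong) (auto simp: indicator_def not_le intro!: supp[symmetric])

end

lemma norm_prim_le:
  assumes "integrable lborel f"
  shows "norm (prim f y) \<le> (LINT t|lborel. norm (f t))"
proof -
  have "norm (prim f y) \<le> (LINT t|lborel. norm (indicator {..y} t * f t))"
    unfolding prim_def by (rule integral_norm_bound)
  also have "\<dots> \<le> (LINT t|lborel. norm (f t))"
  proof (rule integral_mono_AE)
    have "integrable lborel (\<lambda>t. norm (indicator {..y} t *\<^sub>R f t))"
      by (intro integrable_norm integrable_mult_indicator assms) simp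
    moreover have "(\<lambda>t. norm (indicator {..y} t *\<^sub>R f t)) = (\<lambda>t. norm (indicator {..y} t * f t))"
      by (auto simp: indicator_def)
    ultimately show "integrable lborel (\<lambda>t. norm (indicator {..y} t * f t))" by simp
  qed (use assms in \<open>auto simp: indicator_def intro!: AE_I2\<close>)
  finally show ?thesis .
qed

lemma smooth_prim:
  assumes "smooth f" "\<And>x. x \<notin> {a..b} \<Longrightarrow> f x = 0"
  shows "smooth (prim f)"
  by (rule smooth_antiderivative[OF assms(1)], rule prim_has_vector_derivative)
    (use assms smooth_continuous in auto)

text \<open>A smooth transition from 0 to 1 across the unit interval, obtained as a normalised
  primitive. Its derivative is the reference weight of mass 1 in the construction of the continuous
  representative; its translates cut off test functions far to the left.\<close>

definition cutoff :: "real \<Rightarrow> complex" where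
  "cutoff y = prim (\<lambda>t. of_real (bump 0 1 0 t)) y / of_real (LINT t|lborel. bump 0 1 0 t)"

lemma bump_support: "x \<notin> {a..b} \<Longrightarrow> complex_of_real (bump a b n x) = 0"
  using bump_eq_0[of x a b n] by auto

lemma smooth_cutoff: "smooth cutoff"
proof -
  have "smooth (prim (\<lambda>t. of_real (bump 0 1 0 t)))"
    using smooth_prim[OF smooth_bump bump_support] .
  from smooth_mult[OF this smooth_const[of "inverse (of_real (LINT t|lborel. bump 0 1 0 t))"]]
  show ?thesis by (simp add: cutoff_def[abs_def] divide_inverse)
qed

lemma cutoff_has_vector_derivative:
  "(cutoff has_vector_derivative of_real (bump 0 1 0 y) / of_real (LINT t|lborel. bump 0 1 0 t)) (at y)"
  unfolding cutoff_def[abs_def]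
  by (intro has_vector_derivative_divide prim_has_vector_derivative[OF smooth_continuous[OF smooth_bump] bump_support])

lemma cutoff_eq_0: "y \<le> 0 \<Longrightarrow> cutoff y = 0"
proof -
  assume "y \<le> 0"
  then have "prim (\<lambda>t. complex_of_real (bump 0 1 0 t)) y = 0"
    unfolding prim_def by (intro integral_eq_zero_AE AE_I2) (auto simp: indicator_def bump_eq_0)
  then show ?thesis by (simp add: cutoff_def)
qed

lemma cutoff_eq_1: "1 \<le> y \<Longrightarrow> cutoff y = 1"
proof -
  assume "1 \<le> y"
  then have "prim (\<lambda>t. complex_of_real (bump 0 1 0 t)) y = (LINT t|lborel. of_real (bump 0 1 0 t))"
    using prim_eq_integral[OF smooth_continuous[OF smooth_bump] bump_support] by blast
  then show ?thesis using integral_bump_pos[of 0 1 0] by (simp add: cutoff_def)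
qed

lemma norm_cutoff_le: "norm (cutoff y) \<le> 1"
  using norm_prim_le[of "\<lambda>t. of_real (bump 0 1 0 t)" y] integrable_bump[of 0 1 0] integral_bump_pos[of 0 1 0] bump_bounds
  by (simp add: cutoff_def norm_divide field_simps)

section \<open>The fundamental lemma of the calculus of variations\<close>

lemma AE_eq_0_if_integral_intervals_0:
  fixes f :: "real \<Rightarrow> real"
  assumes f: "integrable lborel f" and "\<And>a b. a \<le> b \<Longrightarrow> (LINT x|lborel. indicator {a..b} x * f x) = 0"
    and total: "(LINT x|lborel. f x) = 0"
  shows "AE x in lborel. f x = 0"
proof -
  have int: "integrable lborel (\<lambda>x. indicator A x * f x)" if "A \<in> sets borel" for A
    using integrable_mult_indicator[OF _ f, of A] that by simp
  have "(LINT x|lborel. indicator A x * f x) = 0" if "A \<in> sets borel" for A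
    using that
  \<comment> \<open>Closed intervals generate the Borel sets; \<open>total\<close> carries the
    complement case.\<close>
  proof (induction rule: borel_set_induct)
    case (compl A)
    have "(LINT x|lborel. indicator (- A) x * f x) = (LINT x|lborel. f x - indicator A x * f x)"
      by (intro Bochner_Integration.integral_cong) (auto simp: indicator_def)
    also have "\<dots> = (LINT x|lborel. f x) - (LINT x|lborel. indicator A x * f x)"
      by (rule Bochner_Integration.integral_diff) (use f int compl in auto)
    finally show ?case using total compl by simp
  next
    case (union F)
    have "(LINT x:(\<Union>i. F i)|lborel. f x) = (\<Sum>i. (LINT x:F i|lborel. f x))"
    proof (rule lebesgue_integral_countable_add)
      show "set_integrable lborel (\<Union>i. F i) f"
        unfolding set_integrable_def by (rule integrable_mult_indicator[OF _ f]) (use union in auto)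
    qed (use union in \<open>auto simp: disjoint_family_on_def\<close>)
    then show ?case using union.IH by (simp add: set_lebesgue_integral_def)
  qed (use assms in auto)
  then show ?thesis
    by (intro density_unique_real[OF f integrable_zero]) (auto simp: set_lebesgue_integral_def)
qed

text \<open>As the bumps steepen, dominated convergence turns them into indicators of intervals,
  which differ from the closed ones by null sets only.\<close>

lemma AE_eq_0_if_integral_bumps_0:
  fixes w :: "real \<Rightarrow> complex"
  assumes w_meas: "w \<in> borel_measurable borel"
    and loc: "\<And>a b. set_integrable lborel {a..b} w"
    and bumps: "\<And>a b n. a < b \<Longrightarrow> (LINT x|lborel. w x * of_real (bump a b n x)) = 0"
  shows "AE x in lborel. w x = 0"
proof -
  have set_int: "(LINT x:{a..b}|lborel. w x) = 0" for a b
  proof (cases "a < b")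
    case True
    have wint: "integrable lborel (\<lambda>x. indicator {a..b} x *\<^sub>R w x)"
      using loc by (simp add: set_integrable_def)
    have "(\<lambda>n. LINT x|lborel. w x * of_real (bump a b n x))
        \<longlonglongrightarrow> (LINT x|lborel. w x * of_real (indicator {a<..<b} x))"
    proof (rule integral_dominated_convergence[where w = "\<lambda>x. norm (indicator {a..b} x *\<^sub>R w x)"])
      show "integrable lborel (\<lambda>x. norm (indicator {a..b} x *\<^sub>R w x))"
        using wint by (rule integrable_norm)
      show "AE x in lborel. (\<lambda>n. w x * of_real (bump a b n x)) \<longlonglongrightarrow> w x * of_real (indicator {a<..<b} x)"
        by (intro AE_I2 tendsto_intros bump_tendsto)
      show "AE x in lborel. norm (w x * of_real (bump a b n x)) \<le> norm (indicator {a..b} x *\<^sub>R w x)" for n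
        using bump_bounds[of a b n] bump_eq_0[of _ a b n]
        by (intro AE_I2) (auto simp: norm_mult indicator_def intro!: mult_left_le)
    qed (use w_meas in measurable)
    then have "(LINT x|lborel. w x * of_real (indicator {a<..<b} x)) = 0"
      using bumps[OF True] by (simp add: LIMSEQ_const_iff)
    moreover have "(LINT x|lborel. w x * of_real (indicator {a<..<b} x)) = (LINT x:{a..b}|lborel. w x)"
      unfolding set_lebesgue_integral_def
    proof (rule integral_cong_AE)
      show "AE x in lborel. w x * of_real (indicator {a<..<b} x) = indicator {a..b} x *\<^sub>R w x"
        using AE_lborel_singleton[of a] AE_lborel_singleton[of b]
        by eventually_elim (auto simp: indicator_def)
    qed (use w_meas in measurable)
    ultimately show ?thesis by simp
  next
    case False
    then show ?thesis
      unfolding set_lebesgue_integral_def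
      by (intro integral_eq_zero_AE eventually_mono[OF AE_lborel_singleton[of a]]) (auto simp: indicator_def)
  qed
  have "AE x in lborel. x \<in> {-real n..real n} \<longrightarrow> w x = 0" for n
  proof -
    \<comment> \<open>\<open>w\<close> is only locally integrable; truncation supplies the global
      integrability and the total integral that the interval criterion asks for.\<close>
    let ?W = "\<lambda>x. indicator {-real n..real n} x *\<^sub>R w x"
    have W: "integrable lborel ?W"
      using loc by (simp add: set_integrable_def)
    have W_int: "(LINT x|lborel. indicator {a..b} x *\<^sub>R ?W x) = 0" for a b
    proof -
      have "(LINT x|lborel. indicator {a..b} x *\<^sub>R ?W x) = (LINT x:{max a (-real n)..min b (real n)}|lborel. w x)"
        unfolding set_lebesgue_integral_def
        by (intro Bochner_Integration.integral_cong) (auto simp: indicator_def)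
      then show ?thesis by (simp add: set_int)
    qed
    have W_int': "integrable lborel (\<lambda>x. indicator {a..b} x *\<^sub>R ?W x)" for a b
      by (rule integrable_mult_indicator[OF _ W]) simp
    have "AE x in lborel. Re (?W x) = 0"
    proof (rule AE_eq_0_if_integral_intervals_0)
      show "(LINT x|lborel. indicator {a..b} x * Re (?W x)) = 0" for a b
        using integral_Re[OF W_int', of a b] W_int[of a b] by (simp add: mult.assoc)
      show "(LINT x|lborel. Re (?W x)) = 0"
        using integral_Re[OF W] set_int by (simp add: set_lebesgue_integral_def)
    qed (use W in \<open>rule integrable_Re\<close>)
    moreover have "AE x in lborel. Im (?W x) = 0"
    proof (rule AE_eq_0_if_integral_intervals_0)
      show "(LINT x|lborel. indicator {a..b} x * Im (?W x)) = 0" for a b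
        using integral_Im[OF W_int', of a b] W_int[of a b] by (simp add: mult.assoc)
      show "(LINT x|lborel. Im (?W x)) = 0"
        using integral_Im[OF W] set_int by (simp add: set_lebesgue_integral_def)
    qed (use W in \<open>rule integrable_Im\<close>)
    ultimately show ?thesis
      by eventually_elim (auto simp: complex_eq_iff)
  qed
  then have "AE x in lborel. \<forall>n::nat. x \<in> {-real n..real n} \<longrightarrow> w x = 0"
    by (intro iffD2[OF AE_all_countable] allI)
  then show ?thesis
  proof eventually_elim
    case (elim x)
    obtain n :: nat where "\<bar>x\<bar> \<le> real n" using real_arch_simple by blast
    then show ?case using elim by (auto simp: abs_le_iff)
  qed
qed

section \<open>The continuous representative\<close>

lemma L2_measurable: "u \<in> L2 \<Longrightarrow> u \<in> borel_measurable borel"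
  and L2_integrable_norm_square: "u \<in> L2 \<Longrightarrow> integrable lborel (\<lambda>x. (norm (u x))\<^sup>2)"
  by (simp_all add: L2_def)

text \<open>Either \<open>r\<close> is at most \<open>\<delta>\<close> or it is at most
  \<open>r^2 / \<delta>\<close>. Integrated over an interval, this takes the role of the
  Cauchy-Schwarz inequality, with \<open>\<delta>\<close> tuned at each use.\<close>

lemma le_add_square_div:
  fixes r \<delta> :: real assumes "\<delta> > 0" shows "r \<le> \<delta> + r\<^sup>2 / \<delta>"
proof -
  have "0 \<le> (r - \<delta>)\<^sup>2 + r * \<delta>" if "r \<ge> 0" using assms that by simp
  moreover have "r \<le> \<delta> + r\<^sup>2 / \<delta>" if "r < 0"
    using assms that by (smt (verit) divide_nonneg_pos zero_le_power2)
  ultimately show ?thesis using assms by (cases "r \<ge> 0") (auto simp: field_simps power2_eq_square)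
qed

lemma
  assumes "u \<in> L2" "a \<le> b" "\<delta> > 0"
  shows L2_integrable_on_interval: "integrable lborel (\<lambda>x. indicator {a..b} x * norm (u x))"
    and L2_integral_interval_le: "(LINT x|lborel. indicator {a..b} x * norm (u x))
      \<le> \<delta> * (b - a) + (LINT x|lborel. indicator {a..b} x * (norm (u x))\<^sup>2) / \<delta>"
proof -
  note [measurable] = L2_measurable[OF assms(1)]
  have sq: "integrable lborel (\<lambda>x. indicator {a..b} x * (norm (u x))\<^sup>2)"
    using integrable_mult_indicator[OF _ L2_integrable_norm_square[OF assms(1)], of "{a..b}"] by simp
  have ind: "integrable lborel (indicator {a..b} :: real \<Rightarrow> real)"
    by (intro integrable_real_indicator) (auto simp: emeasure_lborel_Icc_eq)
  have bound: "integrable lborel (\<lambda>x. \<delta> * indicator {a..b} x + (indicator {a..b} x * (norm (u x))\<^sup>2) / \<delta>)"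
    using sq ind by auto
  have le: "indicator {a..b} x * norm (u x)
      \<le> \<delta> * indicator {a..b} x + (indicator {a..b} x * (norm (u x))\<^sup>2) / \<delta>" for x
    using le_add_square_div[OF assms(3), of "norm (u x)"] by (simp add: indicator_def)
  show *: "integrable lborel (\<lambda>x. indicator {a..b} x * norm (u x))"
    by (rule Bochner_Integration.integrable_bound[OF bound])
      (use le in \<open>auto simp: abs_of_nonneg intro!: AE_I2 intro: order_trans[OF _ abs_ge_self]\<close>)
  have "(LINT x|lborel. indicator {a..b} x * norm (u x))
      \<le> (LINT x|lborel. \<delta> * indicator {a..b} x + (indicator {a..b} x * (norm (u x))\<^sup>2) / \<delta>)"
    by (intro integral_mono * bound le)
  also have "\<dots> = \<delta> * (b - a) + (LINT x|lborel. indicator {a..b} x * (norm (u x))\<^sup>2) / \<delta>"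
    using sq ind assms(2) by simp
  finally show "(LINT x|lborel. indicator {a..b} x * norm (u x))
      \<le> \<delta> * (b - a) + (LINT x|lborel. indicator {a..b} x * (norm (u x))\<^sup>2) / \<delta>" .
qed

lemma L2_integral_square_interval_le:
  assumes "u \<in> L2"
  shows "(LINT x|lborel. indicator {a..b} x * (norm (u x))\<^sup>2) \<le> (LINT x|lborel. (norm (u x))\<^sup>2)"
  using integrable_mult_indicator[OF _ L2_integrable_norm_square[OF assms], of "{a..b}"]
  by (intro integral_mono L2_integrable_norm_square[OF assms]) (auto simp: indicator_def)

lemma L2_integrable_mult:
  assumes "u \<in> L2" and [measurable]: "\<psi> \<in> borel_measurable borel"
    and "a \<le> b" and le: "\<And>x. norm (\<psi> x) \<le> K * indicator {a..b} x"
  shows "integrable lborel (\<lambda>x. u x * \<psi> x)"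
proof (rule Bochner_Integration.integrable_bound)
  note [measurable] = L2_measurable[OF assms(1)]
  show "integrable lborel (\<lambda>x. K * (indicator {a..b} x * norm (u x)))"
    by (intro integrable_mult_right L2_integrable_on_interval[OF assms(1,3)]) (rule zero_less_one)
  show "AE x in lborel. norm (u x * \<psi> x) \<le> norm (K * (indicator {a..b} x * norm (u x)))"
  proof (rule AE_I2)
    fix x
    have "norm (u x * \<psi> x) \<le> norm (u x) * (K * indicator {a..b} x)"
      using mult_left_mono[OF le norm_ge_zero, of "u x" x] by (simp add: norm_mult)
    also have "\<dots> \<le> norm (K * (indicator {a..b} x * norm (u x)))"
      by (simp add: ac_simps)
    finally show "norm (u x * \<psi> x) \<le> norm (K * (indicator {a..b} x * norm (u x)))" .
  qed
  show "(\<lambda>x. u x * \<psi> x) \<in> borel_measurable lborel" by measurable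
qed

lemma continuous_compact_support_bounded:
  fixes \<psi> :: "real \<Rightarrow> complex"
  assumes "continuous_on UNIV \<psi>" "\<And>x. x \<notin> {a..b} \<Longrightarrow> \<psi> x = 0"
  obtains K where "K \<ge> 0" "\<And>x. norm (\<psi> x) \<le> K * indicator {a..b} x"
proof -
  have "bounded (\<psi> ` {a..b})"
    by (intro compact_imp_bounded compact_continuous_image continuous_on_subset[OF assms(1)]) auto
  then obtain K where "\<And>x. x \<in> {a..b} \<Longrightarrow> norm (\<psi> x) \<le> K"
    unfolding bounded_iff by blast
  then have "norm (\<psi> x) \<le> \<bar>K\<bar> * indicator {a..b} x" for x
    using assms(2)[of x] abs_ge_self[of K] by (cases "x \<in> {a..b}") force+
  then show ?thesis using that[of "\<bar>K\<bar>"] by simp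
qed

lemma L2_integrable_mult_continuous:
  assumes "u \<in> L2" "continuous_on UNIV \<psi>" "\<And>x. x \<notin> {a..b} \<Longrightarrow> \<psi> x = 0" "a \<le> b"
  shows "integrable lborel (\<lambda>x. u x * \<psi> x)"
proof -
  obtain K where "\<And>x. norm (\<psi> x) \<le> K * indicator {a..b} x"
    using continuous_compact_support_bounded[OF assms(2,3)] by blast
  then show ?thesis
    by (intro L2_integrable_mult[OF assms(1) borel_measurable_continuous_onI[OF assms(2)] assms(4)])
qed

lemma weak_deriv_integral:
  assumes "weak_deriv u g" "test_function \<phi>"
  shows "(LINT x|lborel. u x * fun_deriv \<phi> x) = - (LINT x|lborel. g x * \<phi> x)"
  using assms by (simp add: weak_deriv_def dist_eq_def dist_deriv_def dist_of_fun_def neg_eq_iff_add_eq_0 add_eq_0_iff)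

text \<open>The set where two continuous functions differ is open, and a nonempty open set contains
  an interval of positive length. This is the uniqueness behind the description in
  \<open>cont_rep\<close>.\<close>

lemma continuous_AE_eq_imp_eq:
  fixes v v' :: "real \<Rightarrow> complex"
  assumes "continuous_on UNIV v" "continuous_on UNIV v'" "AE x in lborel. v x = v' x"
  shows "v = v'"
proof (rule ccontr)
  assume "v \<noteq> v'"
  then obtain x where x: "v x \<noteq> v' x" by auto
  have "open {x. v x \<noteq> v' x}"
    using assms(1,2) by (intro open_Collect_neq)
  with x obtain e where e: "e > 0" "ball x e \<subseteq> {x. v x \<noteq> v' x}"
    by (auto simp: open_contains_ball)
  have "AE x' in lborel. x' \<notin> {x - e<..<x + e}"
    using assms(3)
    by eventually_elim (use e in \<open>auto simp: ball_def dist_real_def subset_eq abs_less_iff\<close>)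
  then have "{x - e<..<x + e} \<in> null_sets lborel" by (simp add: AE_iff_null_sets)
  then show False using e(1) by auto
qed

lemma cont_rep_eqI:
  assumes "continuous_on UNIV v" "bounded (range v)" "AE x in lborel. v x = u x"
  shows "cont_rep u = v"
  unfolding cont_rep_def
proof (rule the_equality)
  fix v' assume v': "continuous_on UNIV v' \<and> bounded (range v') \<and> (AE x in lborel. v' x = u x)"
  then have "AE x in lborel. v' x = u x" by simp
  then have "AE x in lborel. v' x = v x" using assms(3) by eventually_elim simp
  then show "v' = v" using v' assms(1) by (intro continuous_AE_eq_imp_eq) auto
qed (use assms in blast)

text \<open>Testing \<open>g\<close> against the compactly
  supported primitive of \<open>J - (\<integral>J) \<theta>\<close>, where \<open>\<theta>\<close> is the derivative of the cutoff, produces the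
  kernel below.\<close>

definition rep_kernel :: "real \<Rightarrow> real \<Rightarrow> complex" where
  "rep_kernel s t = indicator {s..} t - cutoff t"

text \<open>The first term is the mean of \<open>u\<close> with respect to the weight
  \<open>fun_deriv cutoff\<close>, the second corrects it to the value at \<open>s\<close>. For
  smooth \<open>u\<close> with derivative \<open>g\<close>, integration by parts turns the
  right-hand side into \<open>u s\<close>.\<close>

definition h1_rep :: "(real \<Rightarrow> complex) \<Rightarrow> (real \<Rightarrow> complex) \<Rightarrow> real \<Rightarrow> complex" where
  "h1_rep u g s = (LINT x|lborel. u x * fun_deriv cutoff x) - (LINT t|lborel. g t * rep_kernel s t)"

lemma rep_kernel_eq_0: "t \<notin> {min s 0..max s 1} \<Longrightarrow> rep_kernel s t = 0"
  by (auto simp: rep_kernel_def indicator_def cutoff_eq_0 cutoff_eq_1)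

lemma norm_rep_kernel_le: "norm (rep_kernel s t) \<le> 2"
  using norm_triangle_ineq4[of "indicator {s..} t" "cutoff t"] norm_cutoff_le[of t]
  by (auto simp: rep_kernel_def indicator_def)

lemma norm_rep_kernel_le': "norm (rep_kernel s t) \<le> 2 * indicator {min s 0..max s 1} t"
  using norm_rep_kernel_le[of s t] rep_kernel_eq_0[of t s]
  by (cases "t \<in> {min s 0..max s 1}") auto

lemma rep_kernel_measurable [measurable]:
  "(\<lambda>(s, t). rep_kernel s t) \<in> borel_measurable (borel \<Otimes>\<^sub>M borel)"
proof -
  note [measurable] = smooth_measurable[OF smooth_cutoff]
  have "(\<lambda>(s, t). (if s \<le> t then 1 else 0) - cutoff t) \<in> borel_measurable (borel \<Otimes>\<^sub>M borel)"
    by measurable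
  moreover have "(\<lambda>(s, t). (if s \<le> t then 1 else 0) - cutoff t) = (\<lambda>(s, t). rep_kernel s t)"
    by (auto simp: rep_kernel_def indicator_def)
  ultimately show ?thesis by simp
qed

lemma fun_deriv_cutoff: "fun_deriv cutoff x = of_real (bump 0 1 0 x) / of_real (LINT t|lborel. bump 0 1 0 t)"
  using fun_deriv_eqI[OF cutoff_has_vector_derivative] by simp

section \<open>The representative: continuity, agreement with \<open>u\<close>, boundedness\<close>

context
  fixes u g :: "real \<Rightarrow> complex"
  assumes u: "u \<in> L2" and g: "g \<in> L2" and ug: "weak_deriv u g"
begin

lemma integrable_mult_rep_kernel: "integrable lborel (\<lambda>t. g t * rep_kernel s t)"
proof (rule L2_integrable_mult[OF g _ _ norm_rep_kernel_le'])
  have "(\<lambda>t. (\<lambda>(s, t). rep_kernel s t) (s, t)) \<in> borel_measurable borel" by measurable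
  then show "rep_kernel s \<in> borel_measurable borel" by simp
qed simp

text \<open>In the difference of two kernels the cutoff cancels and the indicator of
  \<open>{s..<s'}\<close> remains, so the increment is the integral of \<open>g\<close> over that
  interval.\<close>

lemma norm_h1_rep_diff_le:
  assumes "s \<le> s'" "\<delta> > 0"
  shows "norm (h1_rep u g s' - h1_rep u g s) \<le> \<delta> * (s' - s) + (LINT x|lborel. (norm (g x))\<^sup>2) / \<delta>"
proof -
  note [measurable] = L2_measurable[OF g]
  have "h1_rep u g s' - h1_rep u g s = (LINT t|lborel. g t * rep_kernel s t - g t * rep_kernel s' t)"
    by (simp add: h1_rep_def integrable_mult_rep_kernel)
  also have "norm \<dots> \<le> (LINT t|lborel. norm (g t * rep_kernel s t - g t * rep_kernel s' t))"
    by (rule integral_norm_bound)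
  also have "\<dots> \<le> (LINT t|lborel. indicator {s..s'} t * norm (g t))"
  proof (rule integral_mono)
    show "integrable lborel (\<lambda>t. norm (g t * rep_kernel s t - g t * rep_kernel s' t))"
      by (intro integrable_norm Bochner_Integration.integrable_diff integrable_mult_rep_kernel)
    show "norm (g t * rep_kernel s t - g t * rep_kernel s' t) \<le> indicator {s..s'} t * norm (g t)" for t
      using assms(1) by (auto simp: rep_kernel_def indicator_def algebra_simps)
  qed (rule L2_integrable_on_interval[OF g assms])
  also have "\<dots> \<le> \<delta> * (s' - s) + (LINT x|lborel. indicator {s..s'} x * (norm (g x))\<^sup>2) / \<delta>"
    by (rule L2_integral_interval_le[OF g assms])
  also have "\<dots> \<le> \<delta> * (s' - s) + (LINT x|lborel. (norm (g x))\<^sup>2) / \<delta>"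
    using L2_integral_square_interval_le[OF g] assms(2) by (simp add: divide_right_mono)
  finally show ?thesis .
qed

lemma continuous_h1_rep: "continuous_on UNIV (h1_rep u g)"
proof (rule uniformly_continuous_imp_continuous, unfold uniformly_continuous_on_def, intro allI impI)
  fix e :: real assume e: "e > 0"
  define G where "G = (LINT x|lborel. (norm (g x))\<^sup>2)"
  have G: "G \<ge> 0" by (simp add: G_def)
  \<comment> \<open>Large enough for \<open>G / \<delta> < e / 2\<close>, and positive even if
    \<open>G = 0\<close>; steps shorter than \<open>e / (2 * \<delta>)\<close> then keep the other
    term below \<open>e / 2\<close>.\<close>
  define \<delta> where "\<delta> = (2 * G + 1) / e"
  have \<delta>: "\<delta> > 0" "G / \<delta> < e / 2" using e G by (auto simp: \<delta>_def field_simps)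
  have *: "dist (h1_rep u g s') (h1_rep u g s) < e" if "s \<le> s'" "s' - s < e / (2 * \<delta>)" for s s'
  proof -
    have "\<delta> * (s' - s) < e / 2" using that \<delta> by (simp add: field_simps)
    then show ?thesis
      using norm_h1_rep_diff_le[OF that(1) \<delta>(1), folded G_def] \<delta>(2)
      unfolding dist_norm by linarith
  qed
  show "\<exists>d>0. \<forall>x\<in>UNIV. \<forall>x'\<in>UNIV. dist x' x < d \<longrightarrow> dist (h1_rep u g x') (h1_rep u g x) < e"
  proof (intro exI[of _ "e / (2 * \<delta>)"] conjI ballI impI)
    fix x x' :: real assume "dist x' x < e / (2 * \<delta>)"
    then show "dist (h1_rep u g x') (h1_rep u g x) < e"
      using *[of x x'] *[of x' x] by (cases "x \<le> x'") (auto simp: dist_real_def dist_commute)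
  qed (use e \<delta> in simp)
qed

text \<open>The weak derivative is tested against a primitive \<open>\<phi>\<close> of a function
  with integral 0, and Fubini rewrites the pairing of \<open>g\<close> with \<open>\<phi>\<close> as
  the average of the kernel integrals against \<open>J\<close>.\<close>

lemma integral_h1_rep_bump:
  assumes "a < b"
  shows "(LINT x|lborel. h1_rep u g x * of_real (bump a b n x)) = (LINT x|lborel. u x * of_real (bump a b n x))"
proof -
  note [measurable] = L2_measurable[OF g] L2_measurable[OF u]
  define J where "J = (\<lambda>x. complex_of_real (bump a b n x))"
  define I where "I = (LINT x|lborel. J x)"
  define c where "c = (LINT x|lborel. u x * fun_deriv cutoff x)"
  \<comment> \<open>To the right of both supports \<open>prim J\<close> equals \<open>I\<close> and
    the cutoff equals 1; subtracting makes the support compact.\<close>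
  define \<phi> where "\<phi> = (\<lambda>t. prim J t - I * cutoff t)"
  have J_smooth: "smooth J" and J_supp: "\<And>x. x \<notin> {a..b} \<Longrightarrow> J x = 0"
    unfolding J_def by (rule smooth_bump, rule bump_support)
  have J_int: "integrable lborel J"
    using integrable_compact_support[OF smooth_continuous[OF J_smooth] J_supp] .
  note [measurable] = smooth_measurable[OF J_smooth]
  have \<phi>_smooth: "smooth \<phi>"
    unfolding \<phi>_def
    by (intro smooth_diff smooth_mult smooth_const smooth_cutoff smooth_prim[OF J_smooth J_supp])
  have "(\<phi> has_vector_derivative J x - I * fun_deriv cutoff x) (at x)" for x
    unfolding \<phi>_def
    by (intro has_vector_derivative_diff has_vector_derivative_mult_right smooth_has_vector_derivative
        smooth_cutoff prim_has_vector_derivative[OF smooth_continuous[OF J_smooth] J_supp])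
  then have \<phi>_deriv: "fun_deriv \<phi> = (\<lambda>x. J x - I * fun_deriv cutoff x)"
    by (rule fun_deriv_eqI)
  have "\<phi> x = 0" if "x \<notin> {min a 0..max b 1}" for x
  proof (cases "x < min a 0")
    case True
    then show ?thesis
      using prim_eq_0[OF smooth_continuous[OF J_smooth] J_supp] by (simp add: \<phi>_def cutoff_eq_0)
  next
    case False
    then have "b \<le> x" "1 \<le> x" using that by auto
    then show ?thesis
      using prim_eq_integral[OF smooth_continuous[OF J_smooth] J_supp]
      by (simp add: \<phi>_def cutoff_eq_1 I_def)
  qed
  then have "test_function \<phi>" by (rule test_functionI[OF \<phi>_smooth])
  from weak_deriv_integral[OF ug this]
  have "(LINT x|lborel. u x * (J x - I * fun_deriv cutoff x)) = - (LINT t|lborel. g t * \<phi> t)"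
    unfolding \<phi>_deriv .
  moreover have "integrable lborel (\<lambda>x. u x * J x)"
    by (rule L2_integrable_mult_continuous[OF u smooth_continuous[OF J_smooth] J_supp]) (use assms in auto)
  moreover have "integrable lborel (\<lambda>x. u x * fun_deriv cutoff x)"
    by (rule L2_integrable_mult_continuous[OF u smooth_continuous[OF smooth_fun_deriv[OF smooth_cutoff]], of 0 1])
      (auto simp: fun_deriv_cutoff bump_eq_0)
  ultimately have u_J: "(LINT x|lborel. u x * J x) = I * c - (LINT t|lborel. g t * \<phi> t)"
    by (simp add: c_def algebra_simps)
  have \<phi>_eq: "\<phi> t = (LINT s|lborel. J s * rep_kernel s t)" for t
  proof -
    have "integrable lborel (\<lambda>s. indicator {..t} s *\<^sub>R J s)"
      by (rule integrable_mult_indicator[OF _ J_int]) simp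
    moreover have "(\<lambda>s. indicator {..t} s *\<^sub>R J s) = (\<lambda>s. indicator {..t} s * J s)"
      by (auto simp: indicator_def)
    ultimately have "integrable lborel (\<lambda>s. indicator {..t} s * J s)" by simp
    moreover have "J s * rep_kernel s t = indicator {..t} s * J s - J s * cutoff t" for s
      by (auto simp: rep_kernel_def indicator_def algebra_simps)
    ultimately show ?thesis
      using J_int by (simp add: \<phi>_def prim_def I_def)
  qed
  have "integrable (lborel \<Otimes>\<^sub>M lborel) (\<lambda>(s, t). g t * (J s * rep_kernel s t))"
  proof (rule Bochner_Integration.integrable_bound)
    \<comment> \<open>For every \<open>s\<close> in \<open>{a..b}\<close> the kernel vanishes for
      \<open>t\<close> outside this interval. It does not depend on \<open>s\<close>, so the
      dominating function is a product.\<close>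
    let ?A = "indicator {min a 0..max b 1} :: real \<Rightarrow> real"
    have gA: "integrable lborel (\<lambda>t. ?A t * norm (g t))"
      by (rule L2_integrable_on_interval[OF g, of _ _ 1]) (use assms in auto)
    show "integrable (lborel \<Otimes>\<^sub>M lborel) (\<lambda>(s, t). (2 * norm (J s)) * (?A t * norm (g t)))"
      by (rule lborel_pair.Fubini_integrable)
        (use J_int gA in \<open>auto simp: abs_mult\<close>)
    show "AE x in lborel \<Otimes>\<^sub>M lborel. norm (case x of (s, t) \<Rightarrow> g t * (J s * rep_kernel s t))
        \<le> norm (case x of (s, t) \<Rightarrow> (2 * norm (J s)) * (?A t * norm (g t)))"
    proof (intro AE_I2, clarify)
      fix s t
      show "norm (g t * (J s * rep_kernel s t)) \<le> norm ((2 * norm (J s)) * (?A t * norm (g t)))"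
      proof (cases "s \<in> {a..b} \<and> t \<in> {min a 0..max b 1}")
        case True
        have "norm (g t) * (norm (J s) * norm (rep_kernel s t)) \<le> norm (g t) * (norm (J s) * 2)"
          by (intro mult_left_mono norm_rep_kernel_le norm_ge_zero)
        then show ?thesis using True by (simp add: norm_mult ac_simps)
      next
        case False
        then have "t \<notin> {min s 0..max s 1}" if "s \<in> {a..b}"
          using that by (auto simp: min_def max_def split: if_splits)
        then have "J s = 0 \<or> rep_kernel s t = 0"
          using J_supp rep_kernel_eq_0 by blast
        then show ?thesis by auto
      qed
    qed
  qed measurable
  then have "(LINT t|lborel. LINT s|lborel. g t * (J s * rep_kernel s t))
      = (LINT s|lborel. LINT t|lborel. g t * (J s * rep_kernel s t))"
    by (rule lborel_pair.Fubini_integral)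
  moreover have "(LINT t|lborel. g t * (J s * rep_kernel s t)) = J s * (LINT t|lborel. g t * rep_kernel s t)" for s
    by (simp add: mult.left_commute[of "g _" "J _"])
  ultimately have "(LINT t|lborel. g t * \<phi> t) = (LINT s|lborel. J s * (LINT t|lborel. g t * rep_kernel s t))"
    by (simp add: \<phi>_eq)
  also have "\<dots> = (LINT s|lborel. c * J s - h1_rep u g s * J s)"
    by (simp add: h1_rep_def c_def algebra_simps)
  also have "\<dots> = c * I - (LINT s|lborel. h1_rep u g s * J s)"
  proof -
    have "integrable lborel (\<lambda>s. h1_rep u g s * J s)"
      by (rule integrable_compact_support[of _ a b])
        (use J_supp in \<open>auto intro!: continuous_on_mult continuous_h1_rep smooth_continuous[OF J_smooth]\<close>)
    then show ?thesis using J_int by (simp add: I_def)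
  qed
  finally show ?thesis using u_J by (simp add: J_def)
qed

lemma h1_rep_AE_eq: "AE x in lborel. h1_rep u g x = u x"
proof -
  note [measurable] = L2_measurable[OF u] borel_measurable_continuous_onI[OF continuous_h1_rep]
  have int_v: "set_integrable lborel {a..b} (h1_rep u g)" for a b
    by (intro borel_integrable_atLeastAtMost' continuous_on_subset[OF continuous_h1_rep]) simp
  have int_u: "set_integrable lborel {a..b} u" for a b
  proof (cases "a \<le> b")
    case True
    then have "integrable lborel (\<lambda>x. u x * indicator {a..b} x)"
      by (intro L2_integrable_mult[OF u, of _ a b 1]) (auto simp: indicator_def)
    moreover have "(\<lambda>x. u x * indicator {a..b} x) = (\<lambda>x. indicator {a..b} x *\<^sub>R u x)"
      by (auto simp: indicator_def)
    ultimately show ?thesis by (simp add: set_integrable_def)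
  qed (simp add: set_integrable_def)
  have "AE x in lborel. h1_rep u g x - u x = 0"
  proof (rule AE_eq_0_if_integral_bumps_0)
    fix a b :: real and n assume ab: "a < b"
    have "integrable lborel (\<lambda>x. u x * of_real (bump a b n x))"
      by (rule L2_integrable_mult_continuous[OF u smooth_continuous[OF smooth_bump] bump_support])
        (use ab in auto)
    moreover have "integrable lborel (\<lambda>x. h1_rep u g x * of_real (bump a b n x))"
      by (rule integrable_compact_support[of _ a b])
        (auto intro!: continuous_on_mult continuous_h1_rep smooth_continuous[OF smooth_bump] bump_eq_0)
    ultimately show "(LINT x|lborel. (h1_rep u g x - u x) * of_real (bump a b n x)) = 0"
      using integral_h1_rep_bump[OF ab] by (simp add: left_diff_distrib)
  qed (auto intro: set_integral_diff int_v int_u)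
  then show ?thesis by simp
qed

text \<open>On a unit interval the representative varies by at most \<open>1 + G\<close> (increment
  bound with \<open>\<delta> = 1\<close>), while the average of \<open>norm (u y)\<close> there is
  at most \<open>1 + U\<close>. Averaging the triangle inequality over the interval gives
  \<open>2 + G + U\<close>.\<close>

lemma bounded_h1_rep: "bounded (range (h1_rep u g))"
proof -
  let ?v = "h1_rep u g"
  note [measurable] = L2_measurable[OF u] borel_measurable_continuous_onI[OF continuous_h1_rep]
  define G where "G = (LINT x|lborel. (norm (g x))\<^sup>2)"
  define U where "U = (LINT x|lborel. (norm (u x))\<^sup>2)"
  have "norm (?v x) \<le> 2 + G + U" for x
  proof -
    let ?A = "indicator {x..x + 1} :: real \<Rightarrow> real"
    have A_int: "integrable lborel ?A"
      by (intro integrable_real_indicator) (auto simp: emeasure_lborel_Icc_eq)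
    have Au_int: "integrable lborel (\<lambda>y. ?A y * norm (u y))"
      by (rule L2_integrable_on_interval[OF u, of _ _ 1]) auto
    have *: "AE y in lborel. ?A y * norm (?v x) \<le> ?A y * (1 + G) + ?A y * norm (u y)"
      using h1_rep_AE_eq
    proof eventually_elim
      case (elim y)
      have "norm (?v x) \<le> (1 + G) + norm (u y)" if "y \<in> {x..x + 1}"
      proof -
        have "norm (?v y - ?v x) \<le> 1 * (y - x) + G / 1"
          using norm_h1_rep_diff_le[of x y 1] that by (simp add: G_def)
        moreover have "norm (?v x) \<le> norm (?v y) + norm (?v y - ?v x)"
          by (metis norm_triangle_sub norm_minus_commute)
        ultimately show ?thesis using that elim by simp
      qed
      then show ?case by (auto simp: indicator_def)
    qed
    have "norm (?v x) = (LINT y|lborel. ?A y * norm (?v x))"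
      by simp
    also have "\<dots> \<le> (LINT y|lborel. ?A y * (1 + G) + ?A y * norm (u y))"
      by (rule integral_mono_AE[OF _ _ *]) (use A_int Au_int in auto)
    also have "\<dots> = (1 + G) + (LINT y|lborel. ?A y * norm (u y))"
      using A_int Au_int by simp
    also have "(LINT y|lborel. ?A y * norm (u y)) \<le> 1 * ((x + 1) - x) + (LINT y|lborel. ?A y * (norm (u y))\<^sup>2) / 1"
      by (rule L2_integral_interval_le[OF u]) auto
    also have "(LINT y|lborel. ?A y * (norm (u y))\<^sup>2) \<le> U"
      unfolding U_def by (rule L2_integral_square_interval_le[OF u])
    finally show ?thesis by simp
  qed
  then show ?thesis by (auto simp: bounded_iff)
qed

end

lemma
  assumes "u \<in> H1"
  shows continuous_cont_rep: "continuous_on UNIV (cont_rep u)"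
    and bounded_cont_rep: "bounded (range (cont_rep u))"
    and cont_rep_AE_eq: "AE x in lborel. cont_rep u x = u x"
proof -
  obtain g where g: "u \<in> L2" "g \<in> L2" "weak_deriv u g"
    using assms by (auto simp: H1_def)
  note rep = continuous_h1_rep[OF g] bounded_h1_rep[OF g] h1_rep_AE_eq[OF g]
  have "cont_rep u = h1_rep u g" by (rule cont_rep_eqI[OF rep])
  with rep show "continuous_on UNIV (cont_rep u)" "bounded (range (cont_rep u))"
    "AE x in lborel. cont_rep u x = u x" by simp_all
qed

section \<open>Finite signed measures\<close>

lemma finite_signed_borel_measureD:
  assumes "finite_signed_borel_measure m"
  shows "m {} = 0"
    and "\<And>A. range A \<subseteq> sets borel \<Longrightarrow> disjoint_family A \<Longrightarrow> (\<lambda>i::nat. m (A i)) sums m (\<Union>i. A i)"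
  using assms by (auto simp: finite_signed_borel_measure_def)

lemma finite_signed_borel_measure_Un:
  assumes m: "finite_signed_borel_measure m"
    and "A \<in> sets borel" "B \<in> sets borel" "A \<inter> B = {}"
  shows "m (A \<union> B) = m A + m B"
proof -
  have "(\<lambda>i. m (binaryset A B i)) sums m (\<Union>i. binaryset A B i)"
    using assms
    by (intro finite_signed_borel_measureD[OF m])
      (auto simp: range_binaryset_eq disjoint_family_on_def binaryset_def)
  moreover have "(\<lambda>i. m (binaryset A B i)) sums (m A + m B)"
    using binaryset_sums[where f = m] finite_signed_borel_measureD[OF m] by simp
  ultimately show ?thesis using sums_unique2 by (auto simp: UN_binaryset_eq)
qed

lemma finite_signed_borel_measure_uminus:
  "finite_signed_borel_measure m \<Longrightarrow> finite_signed_borel_measure (\<lambda>A. - m A)"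
  by (auto simp: finite_signed_borel_measure_def intro: sums_minus)

text \<open>If \<open>m\<close> is unbounded on the Borel subsets of \<open>A\<close>, then \<open>A\<close> splits into a piece of measure at least
  \<open>1\<close> in absolute value and a piece on which \<open>m\<close> is still unbounded; iterating yields a disjoint
  sequence whose measures are not summable.\<close>

lemma finite_signed_borel_measure_bounded:
  assumes m: "finite_signed_borel_measure m"
  obtains K where "\<And>A. A \<in> sets borel \<Longrightarrow> \<bar>m A\<bar> \<le> K"
proof -
  define bad where "bad A \<longleftrightarrow> A \<in> sets borel \<and> (\<forall>K. \<exists>B\<in>sets borel. B \<subseteq> A \<and> K < \<bar>m B\<bar>)" for A
  have split: "\<exists>A'. bad A' \<and> A' \<subseteq> A \<and> 1 \<le> \<bar>m (A - A')\<bar>" if A: "bad A" for A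
  proof -
    \<comment> \<open>The threshold makes both pieces large: additivity gives \<open>\<bar>m (A -
      B)\<bar> \<ge> \<bar>m B\<bar> - \<bar>m A\<bar> > 1\<close>. Whichever piece stays bad, the
      discarded one has absolute measure at least 1.\<close>
    obtain B where B: "B \<in> sets borel" "B \<subseteq> A" "1 + \<bar>m A\<bar> < \<bar>m B\<bar>"
      using A unfolding bad_def by blast
    have A_borel: "A \<in> sets borel" using A by (simp add: bad_def)
    have mA: "m A = m B + m (A - B)"
      using finite_signed_borel_measure_Un[OF m B(1), of "A - B"] B A_borel
      by (simp add: Un_absorb1)
    have "bad B \<or> bad (A - B)"
    proof (rule ccontr)
      assume "\<not> ?thesis"
      then obtain K K' where K: "\<And>C. C \<in> sets borel \<Longrightarrow> C \<subseteq> B \<Longrightarrow> \<bar>m C\<bar> \<le> K"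
        "\<And>C. C \<in> sets borel \<Longrightarrow> C \<subseteq> A - B \<Longrightarrow> \<bar>m C\<bar> \<le> K'"
        unfolding bad_def using B A_borel by (meson not_le sets.Diff)
      have "\<bar>m C\<bar> \<le> K + K'" if C: "C \<in> sets borel" "C \<subseteq> A" for C
      proof -
        have "m (C \<inter> B \<union> (C - B)) = m (C \<inter> B) + m (C - B)"
          using B C by (intro finite_signed_borel_measure_Un[OF m]) auto
        then have "m C = m (C \<inter> B) + m (C - B)" by (simp add: Int_Diff_Un)
        moreover have "\<bar>m (C \<inter> B)\<bar> \<le> K" "\<bar>m (C - B)\<bar> \<le> K'"
          using B C by (auto intro!: K)
        ultimately show ?thesis by linarith
      qed
      then show False using A unfolding bad_def by (meson not_le)
    qed
    then show ?thesis
    proof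
      assume "bad B"
      then show ?thesis using B mA by (intro exI[of _ B]) auto
    next
      assume "bad (A - B)"
      moreover have "A - (A - B) = B" using B by auto
      ultimately show ?thesis using B by (intro exI[of _ "A - B"]) auto
    qed
  qed
  have "\<not> bad UNIV"
  proof
    assume "bad UNIV"
    then obtain A where A: "\<And>n. bad (A n)" "\<And>n. A (Suc n) \<subseteq> A n" "\<And>n. 1 \<le> \<bar>m (A n - A (Suc n))\<bar>"
      using dependent_nat_choice[of "\<lambda>_. bad" "\<lambda>_ A A'. A' \<subseteq> A \<and> 1 \<le> \<bar>m (A - A')\<bar>"] split by metis
    have "decseq A" using A(2) by (rule decseq_SucI)
    have "disjoint_family (\<lambda>n. A n - A (Suc n))"
      unfolding disjoint_family_on_def
    proof (intro ballI impI)
      have "(A i - A (Suc i)) \<inter> (A j - A (Suc j)) = {}" if "i < j" for i j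
        using decseqD[OF \<open>decseq A\<close>, of "Suc i" j] that by auto
      then show "(A i - A (Suc i)) \<inter> (A j - A (Suc j)) = {}" if "i \<noteq> j" for i j
        using that by (metis Int_commute linorder_neqE_nat)
    qed
    moreover have "range (\<lambda>n. A n - A (Suc n)) \<subseteq> sets borel"
      using A(1) by (auto simp: bad_def)
    ultimately have "(\<lambda>n. m (A n - A (Suc n))) \<longlonglongrightarrow> 0"
      using finite_signed_borel_measureD(2)[OF m] by (blast intro: summable_LIMSEQ_zero sums_summable)
    from tendstoD[OF this zero_less_one]
    have "\<forall>\<^sub>F n in sequentially. \<bar>m (A n - A (Suc n))\<bar> < 1" by (simp add: dist_real_def)
    then show False using A(3) by (auto simp: eventually_sequentially not_le[symmetric])
  qed
  then show ?thesis using that unfolding bad_def by (auto simp: not_less)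
qed

section \<open>Variations and the domination of integrals against u_c V\<close>

lemma sets_pos_variation [simp, measurable_cong]: "sets (pos_variation m) = sets borel"
  and space_pos_variation [simp]: "space (pos_variation m) = UNIV"
  unfolding pos_variation_def
  using sigma_algebra.sets_measure_of_eq[OF sets.sigma_algebra_axioms[of borel]]
  by (simp_all add: space_measure_of_conv)

lemma sets_neg_variation [simp, measurable_cong]: "sets (neg_variation m) = sets borel"
  and space_neg_variation [simp]: "space (neg_variation m) = UNIV"
  by (simp_all add: neg_variation_def)

text \<open>Only an inequality: unless the set function defining it is countably additive,
  \<^const>\<open>pos_variation\<close> is the zero measure.\<close>

lemma emeasure_pos_variation_le:
  "emeasure (pos_variation m) A \<le> (SUP B\<in>{B \<in> sets borel. B \<subseteq> A}. ennreal (m B))"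
  unfolding pos_variation_def
  by (subst emeasure_measure_of_conv) auto

lemma finite_measure_pos_variation:
  assumes "finite_signed_borel_measure m"
  shows "finite_measure (pos_variation m)"
proof (rule finite_measureI)
  obtain K where K: "\<And>A. A \<in> sets borel \<Longrightarrow> \<bar>m A\<bar> \<le> K"
    using finite_signed_borel_measure_bounded[OF assms] by blast
  have "emeasure (pos_variation m) UNIV \<le> (SUP B\<in>{B \<in> sets borel. B \<subseteq> UNIV}. ennreal (m B))"
    by (rule emeasure_pos_variation_le)
  also have "\<dots> \<le> ennreal K"
    using K by (intro SUP_least ennreal_leI) (auto dest: abs_le_D1)
  also have "\<dots> < \<infinity>" by simp
  finally show "emeasure (pos_variation m) (space (pos_variation m)) \<noteq> \<infinity>" by simp
qed

lemma finite_measure_neg_variation: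
  "finite_signed_borel_measure m \<Longrightarrow> finite_measure (neg_variation m)"
  unfolding neg_variation_def
  by (intro finite_measure_pos_variation finite_signed_borel_measure_uminus)

text \<open>This stands in for |V|. Two properties are used: it dominates both variations, and it is
  finite when \<open>m\<close> is a finite signed measure.\<close>

definition variation_bound :: "(real set \<Rightarrow> real) \<Rightarrow> real measure" where
  "variation_bound m = sup_measure' (pos_variation m) (neg_variation m)"

lemma sets_variation_bound [simp, measurable_cong]: "sets (variation_bound m) = sets borel"
  and space_variation_bound [simp]: "space (variation_bound m) = UNIV"
  by (simp_all add: variation_bound_def)

lemma pos_variation_le_variation_bound: "pos_variation m \<le> variation_bound m"
  and neg_variation_le_variation_bound: "neg_variation m \<le> variation_bound m"
  by (simp_all add: le_measure variation_bound_def le_emeasure_sup_measure'1 le_emeasure_sup_measure'2)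

lemma finite_measure_variation_bound:
  assumes "finite_signed_borel_measure m"
  shows "finite_measure (variation_bound m)"
proof (rule finite_measureI)
  interpret P: finite_measure "pos_variation m" by (rule finite_measure_pos_variation[OF assms])
  interpret N: finite_measure "neg_variation m" by (rule finite_measure_neg_variation[OF assms])
  have "emeasure (variation_bound m) UNIV
      \<le> emeasure (pos_variation m) UNIV + emeasure (neg_variation m) UNIV"
    unfolding variation_bound_def
    by (subst emeasure_sup_measure') (auto intro!: SUP_least add_mono emeasure_mono)
  also have "\<dots> < \<infinity>"
    by (auto simp: less_top[symmetric])
  finally show "emeasure (variation_bound m) (space (variation_bound m)) \<noteq> \<infinity>" by simp
qed

text \<open>Each of the two integrals is at most the integral of the norm against the common upper
  bound, whence the factor 2. If \<open>f\<close> is not integrable for one of the variations, the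
  Bochner integral is 0 by convention and the estimate still holds.\<close>

lemma nn_integral_norm_signed_integral_le:
  assumes "f \<in> borel_measurable borel"
  shows "ennreal (norm (signed_integral m f)) \<le> 2 * (\<integral>\<^sup>+x. norm (f x) \<partial>variation_bound m)"
proof -
  have le: "ennreal (norm (LINT x|M. f x)) \<le> (\<integral>\<^sup>+x. norm (f x) \<partial>variation_bound m)"
    if M: "M \<le> variation_bound m" "sets M = sets borel" for M
  proof (cases "integrable M f")
    case True
    then have "ennreal (norm (LINT x|M. f x)) \<le> (\<integral>\<^sup>+x. norm (f x) \<partial>M)"
      by (rule integral_norm_bound_ennreal)
    also have "\<dots> \<le> (\<integral>\<^sup>+x. norm (f x) \<partial>variation_bound m)"
      by (rule nn_integral_mono_measure) (use M in auto)
    finally show ?thesis .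
  qed (simp add: not_integrable_integral_eq)
  have "ennreal (norm (signed_integral m f))
      \<le> ennreal (norm (LINT x|pos_variation m. f x) + norm (LINT x|neg_variation m. f x))"
    unfolding signed_integral_def by (intro ennreal_leI norm_triangle_ineq4)
  also have "\<dots> \<le> (\<integral>\<^sup>+x. norm (f x) \<partial>variation_bound m) + (\<integral>\<^sup>+x. norm (f x) \<partial>variation_bound m)"
    by (subst ennreal_plus)
      (auto intro!: add_mono le pos_variation_le_variation_bound neg_variation_le_variation_bound)
  finally show ?thesis by (simp add: mult_2)
qed

text \<open>Every Borel subset \<open>B\<close> of \<open>A\<close> has \<open>m' B\<close> at most
  twice the integral of \<open>norm (v x)\<close> over \<open>A\<close>, and the supremum over
  \<open>B\<close> bounds the variation. An inequality as hypothesis covers the real and imaginary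
  parts of the product, with either sign, in one statement.\<close>

lemma pos_variation_le_density:
  assumes [measurable]: "v \<in> borel_measurable borel"
    and le: "\<And>A. A \<in> sets borel \<Longrightarrow> m' A \<le> norm (times_measure v m A)"
  shows "pos_variation m' \<le> density (variation_bound m) (\<lambda>x. 2 * ennreal (norm (v x)))"
proof (subst le_measure)
  show "\<forall>A\<in>sets (pos_variation m'). emeasure (pos_variation m') A
      \<le> emeasure (density (variation_bound m) (\<lambda>x. 2 * ennreal (norm (v x)))) A"
  proof
    fix A assume "A \<in> sets (pos_variation m')"
    then have A [measurable]: "A \<in> sets borel" by simp
    have "emeasure (pos_variation m') A \<le> (SUP B\<in>{B \<in> sets borel. B \<subseteq> A}. ennreal (m' B))"
      by (rule emeasure_pos_variation_le)
    also have "\<dots> \<le> (\<integral>\<^sup>+x. 2 * ennreal (norm (v x)) * indicator A x \<partial>variation_bound m)"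
    proof (rule SUP_least)
      fix B assume "B \<in> {B \<in> sets borel. B \<subseteq> A}"
      then have [measurable]: "B \<in> sets borel" and BA: "B \<subseteq> A" by auto
      have "ennreal (m' B) \<le> ennreal (norm (signed_integral m (\<lambda>x. indicator B x * v x)))"
        using le[of B] by (intro ennreal_leI) (simp add: times_measure_def)
      also have "\<dots> \<le> 2 * (\<integral>\<^sup>+x. norm (indicator B x * v x) \<partial>variation_bound m)"
        by (rule nn_integral_norm_signed_integral_le) measurable
      also have "\<dots> \<le> 2 * (\<integral>\<^sup>+x. ennreal (norm (v x)) * indicator A x \<partial>variation_bound m)"
        using BA by (intro mult_left_mono nn_integral_mono) (auto simp: indicator_def)
      also have "\<dots> = (\<integral>\<^sup>+x. 2 * ennreal (norm (v x)) * indicator A x \<partial>variation_bound m)"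
        by (subst nn_integral_cmult[symmetric]) (auto simp: mult.assoc)
      finally show "ennreal (m' B) \<le> (\<integral>\<^sup>+x. 2 * ennreal (norm (v x)) * indicator A x \<partial>variation_bound m)" .
    qed
    also have "\<dots> = emeasure (density (variation_bound m) (\<lambda>x. 2 * ennreal (norm (v x)))) A"
      by (subst emeasure_density) auto
    finally show "emeasure (pos_variation m') A
        \<le> emeasure (density (variation_bound m) (\<lambda>x. 2 * ennreal (norm (v x)))) A" .
  qed
qed simp

text \<open>Both variations of \<open>m'\<close> lie below the same density; its factor 2, counted
  once for each of them, gives 4.\<close>

lemma norm_signed_integral_times_measure_le:
  assumes [measurable]: "v \<in> borel_measurable borel" "\<phi> \<in> borel_measurable borel"
    and le: "\<And>A. A \<in> sets borel \<Longrightarrow> \<bar>m' A\<bar> \<le> norm (times_measure v m A)"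
  shows "ennreal (norm (signed_integral m' \<phi>))
    \<le> 4 * (\<integral>\<^sup>+x. norm (\<phi> x) * norm (v x) \<partial>variation_bound m)"
proof -
  let ?D = "density (variation_bound m) (\<lambda>x. 2 * ennreal (norm (v x)))"
  have *: "ennreal (norm (LINT x|M. \<phi> x)) \<le> 2 * (\<integral>\<^sup>+x. norm (\<phi> x) * norm (v x) \<partial>variation_bound m)"
    if M: "M \<le> ?D" "sets M = sets borel" for M
  proof (cases "integrable M \<phi>")
    case True
    then have "ennreal (norm (LINT x|M. \<phi> x)) \<le> (\<integral>\<^sup>+x. norm (\<phi> x) \<partial>M)"
      by (rule integral_norm_bound_ennreal)
    also have "\<dots> \<le> (\<integral>\<^sup>+x. norm (\<phi> x) \<partial>?D)"
      by (rule nn_integral_mono_measure) (use M in auto)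
    also have "\<dots> = (\<integral>\<^sup>+x. 2 * ennreal (norm (v x)) * ennreal (norm (\<phi> x)) \<partial>variation_bound m)"
      by (rule nn_integral_density) measurable
    also have "\<dots> = (\<integral>\<^sup>+x. 2 * ennreal (norm (\<phi> x) * norm (v x)) \<partial>variation_bound m)"
      by (simp add: ennreal_mult' ac_simps)
    also have "\<dots> = 2 * (\<integral>\<^sup>+x. norm (\<phi> x) * norm (v x) \<partial>variation_bound m)"
      by (rule nn_integral_cmult) measurable
    finally show ?thesis .
  qed (simp add: not_integrable_integral_eq)
  have "pos_variation m' \<le> ?D" "neg_variation m' \<le> ?D"
    unfolding neg_variation_def using le
    by (auto intro!: pos_variation_le_density dest: abs_le_D1 abs_le_D2)
  note this[THEN *]
  have "ennreal (norm (signed_integral m' \<phi>))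
      \<le> ennreal (norm (LINT x|pos_variation m'. \<phi> x) + norm (LINT x|neg_variation m'. \<phi> x))"
    unfolding signed_integral_def by (intro ennreal_leI norm_triangle_ineq4)
  also have "\<dots> \<le> 2 * (\<integral>\<^sup>+x. norm (\<phi> x) * norm (v x) \<partial>variation_bound m)
      + 2 * (\<integral>\<^sup>+x. norm (\<phi> x) * norm (v x) \<partial>variation_bound m)"
    by (subst ennreal_plus) (auto intro!: add_mono \<open>sets (pos_variation m') = _ \<Longrightarrow> _\<close> \<open>sets (neg_variation m') = _ \<Longrightarrow> _\<close>)
  also have "\<dots> = 4 * (\<integral>\<^sup>+x. norm (\<phi> x) * norm (v x) \<partial>variation_bound m)"
    by (simp flip: distrib_right)
  finally show ?thesis .
qed

lemma norm_dist_of_measure_times_measure_le: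
  assumes [measurable]: "v \<in> borel_measurable borel" "\<phi> \<in> borel_measurable borel"
    and int: "integrable (variation_bound m) (\<lambda>x. norm (\<phi> x) * norm (v x))"
  shows "norm (dist_of_measure (times_measure v m) \<phi>)
    \<le> 8 * (LINT x|variation_bound m. norm (\<phi> x) * norm (v x))"
proof -
  let ?I = "LINT x|variation_bound m. norm (\<phi> x) * norm (v x)"
  have I: "(\<integral>\<^sup>+x. norm (\<phi> x) * norm (v x) \<partial>variation_bound m) = ennreal ?I"
    by (rule nn_integral_eq_integral[OF int]) auto
  have I_nonneg: "?I \<ge> 0" by simp
  have *: "norm (signed_integral m' \<phi>) \<le> 4 * ?I"
    if "\<And>A. A \<in> sets borel \<Longrightarrow> \<bar>m' A\<bar> \<le> norm (times_measure v m A)" for m'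
  proof -
    have "ennreal (norm (signed_integral m' \<phi>)) \<le> 4 * ennreal ?I"
      using norm_signed_integral_times_measure_le[OF assms(1,2) that] I by simp
    also have "\<dots> = ennreal (4 * ?I)"
      by (simp add: ennreal_mult'')
    finally show ?thesis using I_nonneg by (subst (asm) ennreal_le_iff) auto
  qed
  have "norm (dist_of_measure (times_measure v m) \<phi>)
      \<le> norm (signed_integral (\<lambda>A. Re (times_measure v m A)) \<phi>)
        + norm (signed_integral (\<lambda>A. Im (times_measure v m A)) \<phi>)"
    unfolding dist_of_measure_def complex_measure_integral_def
    by (rule order_trans[OF norm_triangle_ineq]) (simp add: norm_mult)
  also have "\<dots> \<le> 4 * ?I + 4 * ?I"
    by (intro add_mono * abs_Re_le_cmod abs_Im_le_cmod)
  finally show ?thesis by simp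
qed

section \<open>The integral inequality for eigenfunctions\<close>

text \<open>A Gronwall argument by small mass: if, below \<open>x\<close>, \<open>v\<close> can be
  nonzero only on a set \<open>A\<close> with \<open>C * measure S A \<le> 1 / 2\<close>, then its
  supremum \<open>M\<close> on \<open>{..x}\<close> satisfies \<open>M \<le> M / 2\<close>.
  Continuity from above of the finite measure provides such sets near -oo and immediately to the
  right of any point, so the zero region has no right end.\<close>

lemma zero_if_le_integral_lessThan:
  fixes v :: "real \<Rightarrow> 'a::{banach, second_countable_topology}"
  assumes "finite_measure S" and [measurable_cong]: "sets S = sets borel"
    and [measurable]: "v \<in> borel_measurable borel" and bounded: "bounded (range v)"
    and C: "C \<ge> 0"
    and le: "\<And>x. norm (v x) \<le> C * (LINT y|S. indicator {..<x} y * norm (v y))"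
  shows "v x = 0"
proof -
  interpret finite_measure S by fact
  have [simp]: "space S = UNIV" using assms(2) by (metis sets_eq_imp_space_eq space_borel)
  obtain B where B: "\<And>x. norm (v x) \<le> B" using bounded by (auto simp: bounded_iff)
  have B0: "0 \<le> B" using B[of 0] norm_ge_zero[of "v 0"] by linarith
  have int: "integrable S (\<lambda>y. indicator A y * norm (v y))" if "A \<in> sets borel" for A
  proof (rule integrable_const_bound[where B = B])
    show "(\<lambda>y. indicator A y * norm (v y)) \<in> borel_measurable S" using that by measurable
  qed (use B B0 in \<open>auto simp: indicator_def\<close>)
  have int_ind: "integrable S (indicator A :: real \<Rightarrow> real)" if "A \<in> sets borel" for A
    using that assms(2) by (intro integrable_real_indicator) (auto simp: less_top[symmetric])
  have step: "\<forall>y\<le>x. v y = 0"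
    if A: "A \<in> sets borel" "C * measure S A \<le> 1 / 2" "\<And>y. y < x \<Longrightarrow> y \<notin> A \<Longrightarrow> v y = 0" for x A
  proof -
    define M where "M = (SUP y\<in>{..x}. norm (v y))"
    have M: "norm (v y) \<le> M" if "y \<le> x" for y
      unfolding M_def using that B by (intro cSUP_upper) (auto intro!: bdd_aboveI)
    have "norm (v y) \<le> M / 2" if y: "y \<le> x" for y
    proof -
      have M0: "0 \<le> M" using M[of x] norm_ge_zero[of "v x"] by linarith
      have "(LINT z|S. indicator {..<y} z * norm (v z)) \<le> (LINT z|S. indicator A z * M)"
      proof (rule integral_mono)
        show "indicator {..<y} z * norm (v z) \<le> indicator A z * M" for z
          using M[of z] A(3)[of z] M0 y by (auto simp: indicator_def)
      qed (use A(1) int int_ind in auto)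
      also have "\<dots> = measure S A * M"
        using A(1) assms(2) by simp
      finally have "C * (LINT z|S. indicator {..<y} z * norm (v z)) \<le> (C * measure S A) * M"
        using C by (simp add: mult_left_mono mult.assoc)
      also have "\<dots> \<le> (1 / 2) * M" using A(2) M0 by (rule mult_right_mono)
      finally show ?thesis using le[of y] by simp
    qed
    then have "M \<le> M / 2"
      unfolding M_def by (intro cSUP_least) auto
    then have "M \<le> 0" by simp
    then show ?thesis using M by (meson norm_le_zero_iff order_trans)
  qed
  have small: "\<exists>n. C * measure S (A n) \<le> 1 / 2"
    if A: "decseq A" "\<And>n. A n \<in> sets borel" "(\<Inter>n. A n) = {}" for A :: "nat \<Rightarrow> real set"
  proof -
    have "(\<lambda>n. measure S (A n)) \<longlonglongrightarrow> measure S (\<Inter>n. A n)"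
      using A(1,2) assms(2) by (intro finite_Lim_measure_decseq) auto
    then have "(\<lambda>n. C * measure S (A n)) \<longlonglongrightarrow> C * 0"
      by (intro tendsto_intros) (simp add: A(3))
    then have "\<forall>\<^sub>F n in sequentially. C * measure S (A n) < 1 / 2"
      by (rule order_tendstoD) simp
    then show ?thesis by (auto simp: eventually_sequentially intro: less_imp_le)
  qed
  define Z where "Z = {x. \<forall>y\<le>x. v y = 0}"
  have "(\<Inter>n. {..<- real n}) = {}"
  proof -
    have "\<exists>n. \<not> y < - real n" for y
      using real_arch_simple[of "- y"] by (metis minus_le_iff not_less)
    then show ?thesis by auto
  qed
  then obtain n0 where "C * measure S {..<- real n0} \<le> 1 / 2"
    using small[of "\<lambda>n. {..<- real n}"] by (auto simp: decseq_def)
  then have "- real n0 \<in> Z"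
    unfolding Z_def using step[of "{..<- real n0}" "- real n0"] by auto
  have "Z = UNIV"
  proof (rule ccontr)
    assume "Z \<noteq> UNIV"
    then obtain x0 where x0: "x0 \<notin> Z" by auto
    \<comment> \<open>\<open>Z\<close> is closed downwards, so a single point outside it is an upper
      bound.\<close>
    have bdd: "bdd_above Z"
    proof (rule bdd_aboveI[of _ x0], rule ccontr)
      fix x assume "x \<in> Z" "\<not> x \<le> x0"
      then show False using x0 by (auto simp: Z_def)
    qed
    define s where "s = Sup Z"
    have below: "v y = 0" if "y < s" for y
    proof -
      have "\<exists>x\<in>Z. y < x"
        using that less_cSup_iff[OF _ bdd, of y] \<open>- real n0 \<in> Z\<close> unfolding s_def by blast
      then show ?thesis by (auto simp: Z_def)
    qed
    \<comment> \<open>The integral stops short of \<open>s\<close>, so \<open>v s = 0\<close>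
      follows whatever mass \<open>S\<close> has at \<open>s\<close>.\<close>
    have "norm (v s) \<le> C * (LINT y|S. indicator {..<s} y * norm (v y))" by (rule le)
    also have "(LINT y|S. indicator {..<s} y * norm (v y)) = 0"
      by (intro integral_eq_zero_AE AE_I2) (auto simp: indicator_def below)
    finally have "v s = 0" by simp
    \<comment> \<open>Leaving out \<open>s\<close>, already known to be a zero of \<open>v\<close>,
      keeps its atom out of these intervals; their intersection is empty and their mass tends to
      0.\<close>
    have "(\<Inter>n. {s<..<s + inverse (real (Suc n))}) = {}"
    proof -
      have "\<exists>n. \<not> y < s + inverse (real (Suc n))" if "y > s" for y
      proof -
        obtain n where "inverse (real (Suc n)) < y - s"
          using reals_Archimedean[of "y - s"] \<open>y > s\<close> by auto
        then have "\<not> y < s + inverse (real (Suc n))" by linarith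
        then show ?thesis ..
      qed
      then show ?thesis by (intro equals0I) (metis INT_D UNIV_I greaterThanLessThan_iff)
    qed
    moreover have "decseq (\<lambda>n. {s<..<s + inverse (real (Suc n))})"
    proof (rule decseq_SucI)
      fix n
      have "inverse (real (Suc (Suc n))) \<le> inverse (real (Suc n))"
        by (intro le_imp_inverse_le) auto
      then show "{s<..<s + inverse (real (Suc (Suc n)))} \<subseteq> {s<..<s + inverse (real (Suc n))}"
        by (auto simp del: of_nat_Suc inverse_le_iff_le)
    qed
    ultimately obtain n where n: "C * measure S {s<..<s + inverse (real (Suc n))} \<le> 1 / 2"
      using small[of "\<lambda>n. {s<..<s + inverse (real (Suc n))}"] by auto
    have "\<forall>y\<le>s + inverse (real (Suc n)). v y = 0"
    proof (rule step[OF _ n])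
      fix y assume "y < s + inverse (real (Suc n))" "y \<notin> {s<..<s + inverse (real (Suc n))}"
      then have "y \<le> s" by auto
      then show "v y = 0" using below \<open>v s = 0\<close> by (cases "y = s") auto
    qed simp
    then have "s + inverse (real (Suc n)) \<in> Z" by (simp add: Z_def)
    then have "s + inverse (real (Suc n)) \<le> s" unfolding s_def using bdd by (rule cSup_upper)
    then show False by (simp add: not_le)
  qed
  then show ?thesis by (auto simp: Z_def)
qed

text \<open>Variation of constants, integrating from the right.\<close>

lemma helmholtz_solution:
  assumes k: "k > 0" and J: "smooth J" "\<And>x. x \<notin> {a..b} \<Longrightarrow> J x = 0"
  defines "I \<equiv> LINT x|lborel. norm (J x)"
  obtains \<phi> where "smooth \<phi>" "\<And>x. fun_deriv (fun_deriv \<phi>) x + (of_real k)\<^sup>2 * \<phi> x = J x"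
    "\<And>x. b \<le> x \<Longrightarrow> \<phi> x = 0" "\<And>x. norm (\<phi> x) \<le> 2 * I / k" "\<And>x. norm (fun_deriv \<phi> x) \<le> 2 * I"
proof -
  define F where "F c x = cis (c * x) * J x" for c x
  \<comment> \<open>This is the integral of \<open>F c\<close> over (x, oo), hence zero from
    \<open>b\<close> on. Its two terms are later estimated separately by \<open>I\<close>, which is
    where the bound \<open>2 * I\<close> comes from.\<close>
  define A where "A c x = (LINT t|lborel. F c t) - prim (F c) x" for c x
  have F: "smooth (F c)" "\<And>x. x \<notin> {a..b} \<Longrightarrow> F c x = 0" for c
    using J unfolding F_def[abs_def] by (auto intro: smooth_mult smooth_cis)
  have F_int: "integrable lborel (F c)" for c
    by (rule integrable_compact_support[OF smooth_continuous[OF F(1)] F(2)])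
  have norm_F: "(LINT x|lborel. norm (F c x)) = I" for c
    by (simp add: F_def I_def norm_mult)
  have A_smooth: "smooth (A c)" for c
    unfolding A_def[abs_def] by (intro smooth_diff smooth_const smooth_prim[OF F])
  have A_deriv: "(A c has_vector_derivative - F c x) (at x)" for c x
    unfolding A_def[abs_def]
    using has_vector_derivative_diff[OF has_vector_derivative_const
        prim_has_vector_derivative[OF smooth_continuous[OF F(1)] F(2)]] by simp
  have A_0: "A c x = 0" if "b \<le> x" for c x
    using prim_eq_integral[OF smooth_continuous[OF F(1)] F(2) that] by (simp add: A_def)
  have A_le: "norm (A c x) \<le> 2 * I" for c x
  proof -
    have "norm (A c x) \<le> norm (LINT t|lborel. F c t) + norm (prim (F c) x)"
      unfolding A_def by (rule norm_triangle_ineq4)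
    also have "\<dots> \<le> I + I"
      using integral_norm_bound[of lborel "F c"] norm_prim_le[OF F_int] norm_F by (intro add_mono) auto
    finally show ?thesis by simp
  qed
  \<comment> \<open>This is the integral of \<open>sin (k * (t - x)) / k * J t\<close> over t > x.
    Splitting the sine into exponentials pulls \<open>x\<close> out of the integrand, so the product
    rule gives the derivatives; \<open>\<phi>'\<close> is minus the integral with
    \<open>cos (k * (t - x))\<close>.\<close>
  define \<phi> where "\<phi> x = (cis (- k * x) * A k x - cis (k * x) * A (- k) x) / (2 * \<i> * of_real k)" for x
  define \<phi>' where "\<phi>' x = (cis (- k * x) * A k x + cis (k * x) * A (- k) x) / (- 2)" for x
  have cis_inv: "cis (k * x) * (cis (- (k * x)) * z) = z" "cis (- (k * x)) * (cis (k * x) * z) = z"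
    "cis (k * x) * cis (- (k * x)) = 1" for x z
    by (simp_all add: mult.assoc[symmetric] cis_mult)
  have cA_deriv: "((\<lambda>x. cis (c * x) * A d x) has_vector_derivative
      cis (c * x) * (- F d x) + \<i> * of_real c * cis (c * x) * A d x) (at x)" for c d x
    by (intro has_vector_derivative_mult has_vector_derivative_cis A_deriv)
  have "(\<phi> has_vector_derivative \<phi>' x) (at x)" for x
    unfolding \<phi>_def[abs_def]
  proof (rule has_vector_derivative_eq_rhs)
    show "((\<lambda>x. (cis (- k * x) * A k x - cis (k * x) * A (- k) x) / (2 * \<i> * of_real k)) has_vector_derivative
      ((cis (- k * x) * (- F k x) + \<i> * of_real (- k) * cis (- k * x) * A k x)
       - (cis (k * x) * (- F (- k) x) + \<i> * of_real k * cis (k * x) * A (- k) x)) / (2 * \<i> * of_real k)) (at x)"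
      by (intro has_vector_derivative_divide has_vector_derivative_diff cA_deriv)
  qed (use k in \<open>simp add: \<phi>'_def F_def cis_inv field_simps\<close>)
  then have deriv_\<phi>: "fun_deriv \<phi> = \<phi>'" by (rule fun_deriv_eqI)
  have "(\<phi>' has_vector_derivative J x - (of_real k)\<^sup>2 * \<phi> x) (at x)" for x
    unfolding \<phi>'_def[abs_def]
  proof (rule has_vector_derivative_eq_rhs)
    show "((\<lambda>x. (cis (- k * x) * A k x + cis (k * x) * A (- k) x) / (- 2)) has_vector_derivative
      ((cis (- k * x) * (- F k x) + \<i> * of_real (- k) * cis (- k * x) * A k x)
       + (cis (k * x) * (- F (- k) x) + \<i> * of_real k * cis (k * x) * A (- k) x)) / (- 2)) (at x)"
      by (intro has_vector_derivative_divide has_vector_derivative_add cA_deriv)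
  qed (use k in \<open>simp add: \<phi>_def F_def cis_inv field_simps power2_eq_square\<close>)
  then have deriv2_\<phi>: "fun_deriv \<phi>' = (\<lambda>x. J x - (of_real k)\<^sup>2 * \<phi> x)" by (rule fun_deriv_eqI)
  have sum_le: "norm (cis (- k * x) * A k x) + norm (cis (k * x) * A (- k) x) \<le> 4 * I" for x
    using A_le[of k x] A_le[of "- k" x] by (simp add: norm_mult)
  show thesis
  proof
    have "smooth (\<lambda>x. (cis (- k * x) * A k x - cis (k * x) * A (- k) x) * (1 / (2 * \<i> * of_real k)))"
      by (intro smooth_mult smooth_diff smooth_cis A_smooth smooth_const)
    then show "smooth \<phi>" unfolding \<phi>_def[abs_def] by simp
    show "fun_deriv (fun_deriv \<phi>) x + (of_real k)\<^sup>2 * \<phi> x = J x" for x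
      by (simp add: deriv_\<phi> deriv2_\<phi>)
    show "\<phi> x = 0" if "b \<le> x" for x using A_0[OF that] by (simp add: \<phi>_def)
    show "norm (\<phi> x) \<le> 2 * I / k" for x
      using order_trans[OF norm_triangle_ineq4 sum_le[of x]] k
      by (simp add: \<phi>_def norm_divide norm_mult field_simps)
    show "norm (fun_deriv \<phi> x) \<le> 2 * I" for x
      using order_trans[OF norm_triangle_ineq sum_le[of x]]
      by (simp add: deriv_\<phi> \<phi>'_def norm_divide)
  qed
qed

text \<open>These are the intervals on which the translated cutoff varies. The square integrals tend
  to 0 by dominated convergence; once they are below \<open>(e / 4)^2\<close>, the interval estimate
  with \<open>\<delta> = e / 4\<close> gives at most \<open>e / 2\<close>.\<close>

lemma L2_integral_tail_tendsto_0:
  assumes "u \<in> L2"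
  shows "(\<lambda>n. LINT x|lborel. indicator {- real n..1 - real n} x * norm (u x)) \<longlonglongrightarrow> 0"
proof (rule LIMSEQ_I)
  fix e :: real assume e: "e > 0"
  note [measurable] = L2_measurable[OF assms]
  have lim: "(\<lambda>n. LINT x|lborel. indicator {- real n..1 - real n} x * (norm (u x))\<^sup>2) \<longlonglongrightarrow> (LINT x|(lborel::real measure). 0)"
  proof (rule integral_dominated_convergence[where w = "\<lambda>x. (norm (u x))\<^sup>2"])
    show "AE x in lborel. (\<lambda>n. indicator {- real n..1 - real n} x * (norm (u x))\<^sup>2) \<longlonglongrightarrow> 0"
    proof (rule AE_I2)
      fix x :: real
      obtain N :: nat where N: "1 - x < real N" using reals_Archimedean2 by blast
      have "\<forall>\<^sub>F n in sequentially. indicator {- real n..1 - real n} x * (norm (u x))\<^sup>2 = 0"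
        using eventually_ge_at_top[of N] by eventually_elim (use N in \<open>auto simp: indicator_def\<close>)
      then show "(\<lambda>n. indicator {- real n..1 - real n} x * (norm (u x))\<^sup>2) \<longlonglongrightarrow> 0"
        by (rule tendsto_eventually)
    qed
    show "integrable lborel (\<lambda>x. (norm (u x))\<^sup>2)" by (rule L2_integrable_norm_square[OF assms])
  qed (auto simp: indicator_def)
  have "0 < (e / 4)\<^sup>2" using e by simp
  from LIMSEQ_D[OF lim this] obtain N where N: "\<And>n. n \<ge> N \<Longrightarrow>
      \<bar>LINT x|lborel. indicator {- real n..1 - real n} x * (norm (u x))\<^sup>2\<bar> < (e / 4)\<^sup>2"
    by auto
  show "\<exists>N. \<forall>n\<ge>N. norm ((LINT x|lborel. indicator {- real n..1 - real n} x * norm (u x)) - 0) < e"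
  proof (intro exI allI impI)
    fix n assume "N \<le> n"
    have "(LINT x|lborel. indicator {- real n..1 - real n} x * norm (u x))
        \<le> e / 4 * (1 - real n - - real n)
          + (LINT x|lborel. indicator {- real n..1 - real n} x * (norm (u x))\<^sup>2) / (e / 4)"
      by (rule L2_integral_interval_le[OF assms]) (use e in auto)
    also have "\<dots> \<le> e / 4 + (e / 4)\<^sup>2 / (e / 4)"
      using N[OF \<open>N \<le> n\<close>] e by (intro add_mono divide_right_mono) auto
    also have "\<dots> < e" using e by (simp add: power2_eq_square)
    finally show "norm ((LINT x|lborel. indicator {- real n..1 - real n} x * norm (u x)) - 0) < e"
      by simp
  qed
qed

section \<open>Testing the eigenvalue equation\<close>

context
  fixes h E :: real and V :: "real set \<Rightarrow> real" and u :: "real \<Rightarrow> complex"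
  assumes h: "h > 0" and E: "E > 0" and V: "finite_signed_borel_measure V" and u: "u \<in> H1"
    and eigen: "dist_eq (schroedinger h V u) (dist_of_fun (\<lambda>x. of_real E * u x))"
begin

lemma u_L2: "u \<in> L2" using u by (simp add: H1_def)

lemma cont_rep_measurable [measurable]: "cont_rep u \<in> borel_measurable borel"
  by (intro borel_measurable_continuous_onI continuous_cont_rep u)

lemma integrable_bounded_mult_cont_rep:
  fixes f :: "real \<Rightarrow> real"
  assumes [measurable]: "f \<in> borel_measurable borel" and "\<And>x. \<bar>f x\<bar> \<le> K"
  shows "integrable (variation_bound V) (\<lambda>x. f x * norm (cont_rep u x))"
proof -
  interpret finite_measure "variation_bound V" by (rule finite_measure_variation_bound[OF V])
  obtain B where B: "\<And>x. norm (cont_rep u x) \<le> B"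
    using bounded_cont_rep[OF u] by (auto simp: bounded_iff)
  show ?thesis
  proof (rule integrable_const_bound[where B = "K * B"])
    show "AE x in variation_bound V. norm (f x * norm (cont_rep u x)) \<le> K * B"
    proof (rule AE_I2)
      fix x
      have "0 \<le> K" using assms(2)[of x] by linarith
      then show "norm (f x * norm (cont_rep u x)) \<le> K * B"
        using assms(2)[of x] B[of x] by (simp add: abs_mult mult_mono)
    qed
  qed measurable
qed

text \<open>With both derivatives moved onto \<open>\<phi>\<close>, the eigenvalue equation
  identifies the integral on the left with the pairing of u_c V with \<open>\<phi>\<close>, to which
  the domination by \<open>variation_bound V\<close> applies.\<close>

lemma norm_integral_operator_le:
  assumes \<phi>: "smooth \<phi>" "\<And>x. x \<notin> {a..b} \<Longrightarrow> \<phi> x = 0" and "a \<le> b"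
  shows "norm (LINT x|lborel. u x * ((of_real h)\<^sup>2 * fun_deriv (fun_deriv \<phi>) x + of_real E * \<phi> x))
    \<le> 8 * (LINT x|variation_bound V. norm (\<phi> x) * norm (cont_rep u x))"
proof -
  have d2: "x \<notin> {a..b} \<Longrightarrow> fun_deriv (fun_deriv \<phi>) x = 0" for x
    by (intro fun_deriv_eq_0[of a b] \<phi>(2)) auto
  have int: "integrable lborel (\<lambda>x. u x * fun_deriv (fun_deriv \<phi>) x)" "integrable lborel (\<lambda>x. u x * \<phi> x)"
    by (rule L2_integrable_mult_continuous[OF u_L2 smooth_continuous _ \<open>a \<le> b\<close>];
        use \<phi> d2 in \<open>auto intro: smooth_fun_deriv\<close>)+
  have "schroedinger h V u \<phi> = dist_of_fun (\<lambda>x. of_real E * u x) \<phi>"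
    using eigen test_functionI[OF \<phi>] unfolding dist_eq_def by blast
  then have "dist_of_measure (times_measure (cont_rep u) V) \<phi>
      = (of_real h)\<^sup>2 * (LINT x|lborel. u x * fun_deriv (fun_deriv \<phi>) x) + of_real E * (LINT x|lborel. u x * \<phi> x)"
    by (simp add: schroedinger_def dist_deriv_def dist_of_fun_def mult.assoc algebra_simps)
  also have "\<dots> = (LINT x|lborel. (of_real h)\<^sup>2 * (u x * fun_deriv (fun_deriv \<phi>) x) + of_real E * (u x * \<phi> x))"
    using int by simp
  also have "\<dots> = (LINT x|lborel. u x * ((of_real h)\<^sup>2 * fun_deriv (fun_deriv \<phi>) x + of_real E * \<phi> x))"
    by (intro Bochner_Integration.integral_cong) (auto simp: algebra_simps)
  finally have *: "dist_of_measure (times_measure (cont_rep u) V) \<phi> = \<dots>" .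
  obtain K where K: "\<And>x. norm (\<phi> x) \<le> K * indicator {a..b} x" "K \<ge> 0"
    using continuous_compact_support_bounded[OF smooth_continuous[OF \<phi>(1)] \<phi>(2)] by blast
  note [measurable] = smooth_measurable[OF \<phi>(1)]
  have "integrable (variation_bound V) (\<lambda>x. norm (\<phi> x) * norm (cont_rep u x))"
  proof (rule integrable_bounded_mult_cont_rep[where K = K])
    show "\<bar>norm (\<phi> x)\<bar> \<le> K" for x
      using K(1)[of x] K(2) by (cases "x \<in> {a..b}") auto
  qed measurable
  then show ?thesis
    unfolding *[symmetric] by (intro norm_dist_of_measure_times_measure_le) measurable
qed

text \<open>The right-hand side depends on the bump only through its mass and its right end
  \<open>b\<close>, not its width; this is what allows shrinking it afterwards.\<close>

lemma norm_integral_bump_le: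
  assumes "a < b"
  shows "norm (LINT x|lborel. u x * of_real (bump a b n x))
    \<le> 16 / (sqrt E * h) * (LINT x|lborel. bump a b n x)
      * (LINT x|variation_bound V. indicator {..<b} x * norm (cont_rep u x))"
proof -
  \<comment> \<open>Chosen so that \<open>h^2 * k^2 = E\<close>: the tested operator is then
    \<open>h^2\<close> times the Helmholtz operator.\<close>
  define k where "k = sqrt E / h"
  have k: "k > 0" and hk: "h\<^sup>2 * k\<^sup>2 = E" "h\<^sup>2 * k = sqrt E * h"
    using h E by (auto simp: k_def power_divide power2_eq_square)
  define J where "J = (\<lambda>x. complex_of_real (bump a b n x))"
  define I where "I = (LINT x|lborel. bump a b n x)"
  let ?F = "LINT x|variation_bound V. indicator {..<b} x * norm (cont_rep u x)"
  have J: "smooth J" "\<And>x. x \<notin> {a..b} \<Longrightarrow> J x = 0"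
    unfolding J_def by (rule smooth_bump, rule bump_support)
  have "(LINT x|lborel. norm (J x)) = I" using bump_bounds by (simp add: J_def I_def)
  with helmholtz_solution[OF k J] obtain \<phi> where \<phi>: "smooth \<phi>"
    "\<And>x. fun_deriv (fun_deriv \<phi>) x + (of_real k)\<^sup>2 * \<phi> x = J x"
    "\<And>x. b \<le> x \<Longrightarrow> \<phi> x = 0" "\<And>x. norm (\<phi> x) \<le> 2 * I / k" "\<And>x. norm (fun_deriv \<phi> x) \<le> 2 * I"
    by metis
  have I0: "I > 0" unfolding I_def by (rule integral_bump_pos[OF assms])
  let ?\<eta>' = "fun_deriv cutoff" and ?\<eta>'' = "fun_deriv (fun_deriv cutoff)"
  have \<eta>': "x \<notin> {0..1} \<Longrightarrow> ?\<eta>' x = 0" for x by (auto simp: fun_deriv_cutoff bump_eq_0)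
  have \<eta>'': "x \<notin> {0..1} \<Longrightarrow> ?\<eta>'' x = 0" for x by (intro fun_deriv_eq_0[of 0 1] \<eta>') auto
  obtain B1 where B1: "B1 \<ge> 0" "\<And>x. norm (?\<eta>' x) \<le> B1 * indicator {0..1} x"
    using continuous_compact_support_bounded[OF smooth_continuous[OF smooth_fun_deriv[OF smooth_cutoff]] \<eta>'] by blast
  obtain B2 where B2: "B2 \<ge> 0" "\<And>x. norm (?\<eta>'' x) \<le> B2 * indicator {0..1} x"
    using continuous_compact_support_bounded[OF
        smooth_continuous[OF smooth_fun_deriv[OF smooth_fun_deriv[OF smooth_cutoff]]] \<eta>''] by blast
  \<comment> \<open>A bound for the cutoff error that is uniform in the cutoff position
    \<open>m\<close>, since all translates share the derivative bounds \<open>B1\<close> and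
    \<open>B2\<close>.\<close>
  define K where "K = 2 * B1 * (2 * I) + B2 * (2 * I / k)"
  define T where "T m = (LINT x|lborel. indicator {- real m..1 - real m} x * norm (u x))" for m
  have bound: "h\<^sup>2 * norm (LINT x|lborel. u x * J x) \<le> 8 * (2 * I / k * ?F) + h\<^sup>2 * (K * T m)"
    \<comment> \<open>The transition of the cutoff then ends at or before \<open>a\<close>, so
      multiplying by it leaves \<open>J\<close> unchanged.\<close>
    if m: "1 - real m \<le> a" for m :: nat
  proof -
    define \<eta> where "\<eta> = (\<lambda>x. cutoff (x + real m))"
    have \<eta>_smooth: "smooth \<eta>" unfolding \<eta>_def by (rule smooth_translate[OF smooth_cutoff])
    have \<eta>_deriv: "fun_deriv \<eta> = (\<lambda>x. ?\<eta>' (x + real m))"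
      "fun_deriv (\<lambda>x. ?\<eta>' (x + real m)) = (\<lambda>x. ?\<eta>'' (x + real m))"
      unfolding \<eta>_def by (intro fun_deriv_translate smooth_cutoff smooth_fun_deriv)+
    define \<psi> where "\<psi> = (\<lambda>x. \<eta> x * \<phi> x)"
    \<comment> \<open>The commutator of the second derivative with multiplication by
      \<open>\<eta>\<close>, applied to \<open>\<phi>\<close>; it lives where \<open>\<eta>\<close>
      varies.\<close>
    define r where "r = (\<lambda>x. 2 * ?\<eta>' (x + real m) * fun_deriv \<phi> x + ?\<eta>'' (x + real m) * \<phi> x)"
    have \<psi>_smooth: "smooth \<psi>" unfolding \<psi>_def by (intro smooth_mult \<eta>_smooth \<phi>(1))
    have r_smooth: "smooth r"
      unfolding r_def
      by (intro smooth_add smooth_mult smooth_const smooth_translate smooth_fun_deriv smooth_cutoff \<phi>(1))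
    have r_le: "norm (r x) \<le> K * indicator {- real m..1 - real m} x" for x
    proof -
      have *: "norm (?\<eta>' (x + real m)) \<le> B1 * indicator {- real m..1 - real m} x"
        "norm (?\<eta>'' (x + real m)) \<le> B2 * indicator {- real m..1 - real m} x"
        using B1(2)[of "x + real m"] B2(2)[of "x + real m"] by (auto simp: indicator_def split: if_splits)
      have "norm (r x) \<le> 2 * norm (?\<eta>' (x + real m)) * norm (fun_deriv \<phi> x)
          + norm (?\<eta>'' (x + real m)) * norm (\<phi> x)"
        unfolding r_def by (rule order_trans[OF norm_triangle_ineq]) (simp add: norm_mult)
      also have "\<dots> \<le> 2 * (B1 * indicator {- real m..1 - real m} x) * (2 * I)
          + (B2 * indicator {- real m..1 - real m} x) * (2 * I / k)"
        using B1(1) B2(1) I0 k by (intro add_mono mult_mono * \<phi>(4,5) order_refl) auto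
      finally show ?thesis by (simp add: K_def algebra_simps)
    qed
    have r_0: "r x = 0" if "x \<notin> {- real m..1 - real m}" for x
      using r_le[of x] that by simp
    \<comment> \<open>The left end comes from the cutoff, the right end from \<open>\<phi>\<close>;
      in general \<open>\<phi>\<close> itself oscillates on to -oo and is no test function.\<close>
    have \<psi>_0: "\<psi> x = 0" if "x \<notin> {- real m..b}" for x
      using that \<phi>(3)[of x] cutoff_eq_0[of "x + real m"] by (auto simp: \<psi>_def \<eta>_def)
    have "fun_deriv \<psi> = (\<lambda>x. \<eta> x * fun_deriv \<phi> x + ?\<eta>' (x + real m) * \<phi> x)"
      unfolding \<psi>_def using fun_deriv_mult[OF \<eta>_smooth \<phi>(1)] by (simp add: \<eta>_deriv)
    then have "fun_deriv (fun_deriv \<psi>) x = (\<eta> x * fun_deriv (fun_deriv \<phi>) x + ?\<eta>' (x + real m) * fun_deriv \<phi> x)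
        + (?\<eta>' (x + real m) * fun_deriv \<phi> x + ?\<eta>'' (x + real m) * \<phi> x)" for x
      by (simp add: fun_deriv_add fun_deriv_mult smooth_mult smooth_translate smooth_fun_deriv smooth_cutoff
          \<eta>_smooth \<phi>(1) \<eta>_deriv)
    moreover have "\<eta> x * J x = J x" for x
      using m J(2)[of x] cutoff_eq_1[of "x + real m"] by (cases "x \<in> {a..b}") (auto simp: \<eta>_def)
    moreover have "fun_deriv (fun_deriv \<phi>) x = J x - (of_real k)\<^sup>2 * \<phi> x" for x
      using \<phi>(2)[of x] by (simp add: algebra_simps)
    ultimately have op: "fun_deriv (fun_deriv \<psi>) x + (of_real k)\<^sup>2 * \<psi> x = J x + r x" for x
      by (simp add: \<psi>_def r_def algebra_simps)
    have "(of_real h)\<^sup>2 * fun_deriv (fun_deriv \<psi>) x + of_real E * \<psi> x = (of_real h)\<^sup>2 * (J x + r x)" for x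
    proof -
      have "complex_of_real E = (of_real h)\<^sup>2 * (of_real k)\<^sup>2"
        using hk(1) by (metis of_real_mult of_real_power)
      then show ?thesis by (simp add: op[symmetric] algebra_simps)
    qed
    then have "(LINT x|lborel. u x * ((of_real h)\<^sup>2 * fun_deriv (fun_deriv \<psi>) x + of_real E * \<psi> x))
        = (LINT x|lborel. (of_real h)\<^sup>2 * (u x * J x + u x * r x))"
      by (intro Bochner_Integration.integral_cong) (auto simp: algebra_simps)
    also have "\<dots> = (of_real h)\<^sup>2 * ((LINT x|lborel. u x * J x) + (LINT x|lborel. u x * r x))"
    proof -
      have "integrable lborel (\<lambda>x. u x * J x)"
        by (rule L2_integrable_mult_continuous[OF u_L2 smooth_continuous[OF J(1)] J(2)]) (use assms in auto)
      moreover have "integrable lborel (\<lambda>x. u x * r x)"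
        by (rule L2_integrable_mult_continuous[OF u_L2 smooth_continuous[OF r_smooth] r_0]) auto
      ultimately show ?thesis by simp
    qed
    finally have eq: "(LINT x|lborel. u x * ((of_real h)\<^sup>2 * fun_deriv (fun_deriv \<psi>) x + of_real E * \<psi> x)) = \<dots>" .
    have r_int: "norm (LINT x|lborel. u x * r x) \<le> K * T m"
    proof -
      note [measurable] = L2_measurable[OF u_L2] smooth_measurable[OF r_smooth]
      have T_int: "integrable lborel (\<lambda>x. indicator {- real m..1 - real m} x * norm (u x))"
        by (rule L2_integrable_on_interval[OF u_L2, of _ _ 1]) auto
      have "norm (LINT x|lborel. u x * r x)
          \<le> (LINT x|lborel. K * (indicator {- real m..1 - real m} x * norm (u x)))"
      proof (rule Bochner_Integration.integral_norm_bound_integral)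
        show "integrable lborel (\<lambda>x. u x * r x)"
          by (rule L2_integrable_mult_continuous[OF u_L2 smooth_continuous[OF r_smooth] r_0]) auto
        show "norm (u x * r x) \<le> K * (indicator {- real m..1 - real m} x * norm (u x))" for x
          using mult_left_mono[OF r_le[of x] norm_ge_zero[of "u x"]] by (simp add: norm_mult ac_simps)
      qed (use T_int in simp)
      then show ?thesis by (simp add: T_def)
    qed
    have "h\<^sup>2 * norm (LINT x|lborel. u x * J x)
        \<le> h\<^sup>2 * (norm ((LINT x|lborel. u x * J x) + (LINT x|lborel. u x * r x)) + K * T m)"
      using r_int norm_diff_ineq[of "LINT x|lborel. u x * J x" "LINT x|lborel. u x * r x"]
      by (intro mult_left_mono) auto
    also have "\<dots> = norm (LINT x|lborel. u x * ((of_real h)\<^sup>2 * fun_deriv (fun_deriv \<psi>) x + of_real E * \<psi> x))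
        + h\<^sup>2 * (K * T m)"
      unfolding eq norm_mult norm_power norm_of_real by (simp only: distrib_left power2_abs)
    also have "norm (LINT x|lborel. u x * ((of_real h)\<^sup>2 * fun_deriv (fun_deriv \<psi>) x + of_real E * \<psi> x))
        \<le> 8 * (LINT x|variation_bound V. norm (\<psi> x) * norm (cont_rep u x))"
      by (rule norm_integral_operator_le[where a = "- real m" and b = b, OF \<psi>_smooth \<psi>_0]) (use m assms in auto)
    also have "(LINT x|variation_bound V. norm (\<psi> x) * norm (cont_rep u x))
        \<le> (LINT x|variation_bound V. (2 * I / k * indicator {..<b} x) * norm (cont_rep u x))"
    proof (rule integral_mono)
      \<comment> \<open>\<open>\<phi>\<close> vanishes at \<open>b\<close> itself, which makes the
        half-line open and excludes an atom of V at \<open>b\<close>.\<close>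
      have \<psi>_le: "norm (\<psi> x) \<le> 2 * I / k * indicator {..<b} x" for x
      proof (cases "x < b")
        case True
        have "norm (\<psi> x) \<le> 1 * (2 * I / k)"
          unfolding \<psi>_def \<eta>_def norm_mult using I0 k by (intro mult_mono norm_cutoff_le \<phi>(4)) auto
        then show ?thesis using True by simp
      qed (use \<phi>(3)[of x] in \<open>simp add: \<psi>_def\<close>)
      then show "norm (\<psi> x) * norm (cont_rep u x) \<le> (2 * I / k * indicator {..<b} x) * norm (cont_rep u x)" for x
        by (intro mult_right_mono) auto
      have "\<bar>2 * I / k * indicator {..<b} x\<bar> \<le> 2 * I / k" for x
        using I0 k by (auto simp: indicator_def)
      then show "integrable (variation_bound V) (\<lambda>x. (2 * I / k * indicator {..<b} x) * norm (cont_rep u x))"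
        by (intro integrable_bounded_mult_cont_rep) auto
      have "\<bar>norm (\<psi> x)\<bar> \<le> 2 * I / k" for x
        using order_trans[OF \<psi>_le[of x], of "2 * I / k"] I0 k by (cases "x < b") auto
      then show "integrable (variation_bound V) (\<lambda>x. norm (\<psi> x) * norm (cont_rep u x))"
        using smooth_measurable[OF \<psi>_smooth] by (intro integrable_bounded_mult_cont_rep) auto
    qed
    also have "\<dots> = 2 * I / k * ?F"
      by (simp only: mult.assoc integral_mult_right_zero)
    finally show ?thesis by simp
  qed
  have "(\<lambda>m. 8 * (2 * I / k * ?F) + h\<^sup>2 * (K * T m)) \<longlonglongrightarrow> 8 * (2 * I / k * ?F) + h\<^sup>2 * (K * 0)"
    unfolding T_def by (intro tendsto_intros L2_integral_tail_tendsto_0[OF u_L2])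
  moreover have "\<forall>\<^sub>F m in sequentially. h\<^sup>2 * norm (LINT x|lborel. u x * J x) \<le> 8 * (2 * I / k * ?F) + h\<^sup>2 * (K * T m)"
  proof -
    obtain N :: nat where "1 - a \<le> real N" using real_arch_simple by blast
    then show ?thesis
      by (intro eventually_mono[OF eventually_ge_at_top[of N]] bound) linarith
  qed
  ultimately have "h\<^sup>2 * norm (LINT x|lborel. u x * J x) \<le> 8 * (2 * I / k * ?F) + h\<^sup>2 * (K * 0)"
    by (intro tendsto_lowerbound[OF _ _ sequentially_bot])
  \<comment> \<open>The 16 is the 8 of the measure estimate times the 2 in the bound for
    \<open>\<phi>\<close>; the denominator equals \<open>sqrt E * h\<close>.\<close>
  then have "norm (LINT x|lborel. u x * J x) \<le> 16 * I * ?F / (h\<^sup>2 * k)"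
    using h k by (simp add: field_simps)
  then show ?thesis unfolding hk by (simp add: J_def I_def)
qed

lemma norm_cont_rep_le:
  "norm (cont_rep u x) \<le> 16 / (sqrt E * h) * (LINT y|variation_bound V. indicator {..<x} y * norm (cont_rep u y))"
proof (rule field_le_epsilon)
  let ?v = "cont_rep u"
  let ?C = "16 / (sqrt E * h) * (LINT y|variation_bound V. indicator {..<x} y * norm (cont_rep u y))"
  fix e :: real assume e: "e > 0"
  have "isCont ?v x" using continuous_cont_rep[OF u] by (simp add: continuous_on_eq_continuous_at)
  then obtain d where d: "d > 0" "\<And>y. dist y x < d \<Longrightarrow> dist (?v y) (?v x) < e"
    using e unfolding continuous_at_eps_delta by (auto simp: dist_commute)
  \<comment> \<open>Ending the bump exactly at \<open>x\<close> keeps the half-line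
    \<open>{..<x}\<close> fixed while \<open>d\<close> follows the modulus of continuity of u_c at
    \<open>x\<close>; dividing by the mass \<open>I\<close> then leaves the value at
    \<open>x\<close> up to \<open>e\<close>.\<close>
  define J where "J = bump (x - d) x 0"
  define I where "I = (LINT y|lborel. J y)"
  have I: "I > 0" unfolding I_def J_def using d(1) by (intro integral_bump_pos) simp
  have J_int: "integrable lborel J" unfolding J_def by (rule integrable_bump)
  have vJ_int: "integrable lborel (\<lambda>y. ?v y * of_real (J y))"
    unfolding J_def
    by (rule integrable_compact_support[of _ "x - d" x])
      (auto intro!: continuous_on_mult continuous_cont_rep[OF u] smooth_continuous[OF smooth_bump] bump_eq_0)
  have "(LINT y|lborel. ?v y * of_real (J y)) = (LINT y|lborel. u y * of_real (J y))"
  proof (rule integral_cong_AE)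
    show "AE y in lborel. ?v y * of_real (J y) = u y * of_real (J y)"
      using cont_rep_AE_eq[OF u] by eventually_elim simp
  qed (use L2_measurable[OF u_L2] in \<open>auto simp: J_def\<close>)
  then have vJ: "norm (LINT y|lborel. ?v y * of_real (J y)) \<le> ?C * I"
    using norm_integral_bump_le[of "x - d" x 0] d(1) by (simp add: J_def I_def mult.commute mult.left_commute)
  have "norm (?v x) * I = norm (LINT y|lborel. ?v x * of_real (J y))"
    using I by (simp add: norm_mult I_def)
  also have "(LINT y|lborel. ?v x * of_real (J y))
      = (LINT y|lborel. ?v y * of_real (J y)) - (LINT y|lborel. (?v y - ?v x) * of_real (J y))"
    using vJ_int J_int by (simp add: left_diff_distrib)
  also have "norm \<dots> \<le> ?C * I + norm (LINT y|lborel. (?v y - ?v x) * of_real (J y))"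
    by (rule order_trans[OF norm_triangle_ineq4]) (use vJ in simp)
  also have "norm (LINT y|lborel. (?v y - ?v x) * of_real (J y)) \<le> (LINT y|lborel. e * J y)"
  proof (rule Bochner_Integration.integral_norm_bound_integral)
    show "integrable lborel (\<lambda>y. (?v y - ?v x) * of_real (J y))"
      using vJ_int J_int by (simp add: left_diff_distrib)
    show "norm ((?v y - ?v x) * of_real (J y)) \<le> e * J y" for y
    proof (cases "y \<in> {x - d<..<x}")
      case True
      then have "norm (?v y - ?v x) \<le> e"
        using d(2)[of y] by (simp add: dist_norm)
      then show ?thesis using bump_bounds[of "x - d" x 0 y] by (simp add: norm_mult J_def mult_right_mono)
    qed (simp add: J_def bump_eq_0)
  qed (use J_int in simp)
  also have "(LINT y|lborel. e * J y) = e * I" by (simp add: I_def)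
  also have "?C * I + e * I = (?C + e) * I" by (simp add: distrib_right)
  finally show "norm (?v x) \<le> ?C + e" using I by (simp add: mult_le_cancel_right)
qed

lemma eigenfunction_AE_eq_0: "AE x in lborel. u x = 0"
proof -
  have "cont_rep u x = 0" for x
    by (rule zero_if_le_integral_lessThan[OF finite_measure_variation_bound[OF V] sets_variation_bound
          cont_rep_measurable bounded_cont_rep[OF u] _ norm_cont_rep_le])
      (use h E in simp)
  then show ?thesis using cont_rep_AE_eq[OF u] by simp
qed

end

theorem corollary1p3:
  fixes V :: "real \<Rightarrow> real set \<Rightarrow> real"
  assumes "\<And>h. h > 0 \<Longrightarrow> finite_signed_borel_measure (V h)"
  shows "\<forall>h>0. \<not> (\<exists>E::real. E > 0 \<and> schroedinger_eigenvalue h (V h) (complex_of_real E))"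
proof (intro allI impI notI, elim exE conjE)
  fix h E :: real
  assume "h > 0" "E > 0" "schroedinger_eigenvalue h (V h) (complex_of_real E)"
  then obtain u where "u \<in> H1" "\<not> (AE x in lborel. u x = 0)"
    "dist_eq (schroedinger h (V h) u) (dist_of_fun (\<lambda>x. of_real E * u x))"
    by (auto simp: schroedinger_eigenvalue_def schroedinger_domain_def)
  with \<open>h > 0\<close> \<open>E > 0\<close> show False
    using eigenfunction_AE_eq_0[OF _ _ assms] by blast
qed

end
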